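(* Let $Q\subset\mathbb{R}^2$ be any convex polygon. Then for every integer $n\ge 1$, $$p(n)=\sum_{j=0}^{n-1}N_c(j),$$ where $p$ is the complexity function of the billiard in $Q$ coded by its sides, and $N_c(j)$ is the number of generalized diagonals of $Q$ of combinatorial length at most $j$.
   Context: Billiard: a point mass moves inside a polygon $Q\subset\mathbb{R}^2$ with unit speed along a straight line until it reaches the boundary $\partial Q$, where it changes direction by the law "angle of incidence equals angle of reflection", and then continues along the new line. An orbit is not continued after it reaches a vertex. Complexity: label the sides of $Q$ by distinct symbols of a finite alphabet $\mathcal{A}$ whose cardinality is the number of sides of $Q$. Code a billiard orbit (avoiding the vertices) by the sequence of sides it hits. $\mathcal{L}(n)$ is the set of all words of length $n$ over $\mathcal{A}$ that arise as $n$ consecutive sides hit by such an orbit, and $p(n)=\#\mathcal{L}(n)$. Generalized diagonals: a generalized diagonal is an oriented billiard orbit segment (determined by its starting vertex and initial direction) which begins and ends in a vertex of $Q$ and contains no vertex of $Q$ in its interior. Its combinatorial length is the number of its links (straight segments between consecutive boundary hits). The sides of $Q$ are not counted as generalized diagonals. $N_c(n)$ is the number of generalized diagonals of combinatorial length at most $n$, with the convention that $N_c(0)$ is the number of vertices of $Q$, i.e. each vertex counts as one generalized diagonal of combinatorial length $0$ (and so contributes to $N_c(n)$ for every $n\ge 0$). *)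

theory Defs
  imports "HOL-Analysis.Analysis"
begin

type_synonym plane = "real^2"

definition convex_polygon :: "plane set \<Rightarrow> bool" where
  "convex_polygon Q \<longleftrightarrow> polytope Q \<and> interior Q \<noteq> {}"

definition vertices :: "plane set \<Rightarrow> plane set" where
  "vertices Q = {a. a extreme_point_of Q}"

definition sides :: "plane set \<Rightarrow> plane set set" where
  "sides Q = {S. S edge_of Q}"

(* Reflection in the line through the origin orthogonal to n. *)
definition reflect :: "plane \<Rightarrow> plane \<Rightarrow> plane" where
  "reflect n v = v - (2 * (v \<bullet> n) / (n \<bullet> n)) *\<^sub>R n"

(* A straight piece of trajectory between two consecutive hits of the boundary.
   Asking for the open segment to lie in the interior of Q excludes motion along a side. *)
definition billiard_link :: "plane set \<Rightarrow> plane \<Rightarrow> plane \<Rightarrow> bool" where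
  "billiard_link Q x y \<longleftrightarrow>
     x \<in> frontier Q \<and> y \<in> frontier Q \<and> x \<noteq> y \<and> open_segment x y \<subseteq> interior Q"

(* The trajectory coming from x bounces at the non-vertex y towards z: the unit directions
   before and after the hit are mirror images in the side through y (with normal n), i.e. the
   angle of incidence equals the angle of reflection. *)
definition bounce :: "plane set \<Rightarrow> plane \<Rightarrow> plane \<Rightarrow> plane \<Rightarrow> bool" where
  "bounce Q x y z \<longleftrightarrow>
     y \<notin> vertices Q \<and>
     (\<exists>S\<in>sides Q. \<exists>n. y \<in> S \<and> n \<noteq> 0 \<and> (\<forall>p\<in>S. orthogonal n (p - y)) \<and>
        sgn (z - y) = reflect n (sgn (y - x)))"

(* An orbit avoiding the vertices, given by its consecutive hits of the boundary. Orbits stop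
   at vertices, so avoiding them means that the orbit is infinite. *)
definition billiard_orbit :: "plane set \<Rightarrow> (nat \<Rightarrow> plane) \<Rightarrow> bool" where
  "billiard_orbit Q x \<longleftrightarrow>
     (\<forall>i. x i \<notin> vertices Q \<and> billiard_link Q (x i) (x (Suc i)) \<and>
          bounce Q (x i) (x (Suc i)) (x (Suc (Suc i))))"

definition billiard_language :: "(plane set \<Rightarrow> 'a) \<Rightarrow> plane set \<Rightarrow> nat \<Rightarrow> 'a list set" where
  "billiard_language lab Q n =
     {w. length w = n \<and>
         (\<exists>x m. billiard_orbit Q x \<and>
            (\<forall>i<n. \<exists>S\<in>sides Q. x (m + i) \<in> S \<and> w ! i = lab S))}"

definition complexity :: "(plane set \<Rightarrow> 'a) \<Rightarrow> plane set \<Rightarrow> nat \<Rightarrow> nat" where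
  "complexity lab Q n = card (billiard_language lab Q n)"

(* A generalized diagonal with k links is the list of its k + 1 consecutive boundary points;
   for k = 0 these are the one-element lists [a] with a a vertex. Since the motion from a
   given vertex in a given direction stops at the first vertex reached, the list corresponds
   one-to-one to the pair (starting vertex, initial direction) when k \<ge> 1. *)
definition generalized_diagonal :: "plane set \<Rightarrow> plane list \<Rightarrow> bool" where
  "generalized_diagonal Q xs \<longleftrightarrow>
     xs \<noteq> [] \<and> hd xs \<in> vertices Q \<and> last xs \<in> vertices Q \<and>
     (\<forall>i. Suc i < length xs \<longrightarrow> billiard_link Q (xs ! i) (xs ! Suc i)) \<and>
     (\<forall>i. Suc (Suc i) < length xs \<longrightarrow> bounce Q (xs ! i) (xs ! Suc i) (xs ! Suc (Suc i)))"

definition combinatorial_length :: "plane list \<Rightarrow> nat" where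
  "combinatorial_length xs = length xs - 1"

definition num_gen_diagonals :: "plane set \<Rightarrow> nat \<Rightarrow> nat" where
  "num_gen_diagonals Q n =
     card {xs. generalized_diagonal Q xs \<and> combinatorial_length xs \<le> n}"

end

theory Submission
  imports Defs
begin

text \<open>After unfolding, the trajectories with a given code form a convex set of oriented lines, and the
  vertices ahead cut this set along hyperplanes. These do not meet inside the set, because a line through the
  interior of \<open>Q\<close> leaves \<open>Q\<close> in a single point. So a word has one extension more than there are
  vertices which its trajectories can run into, and \<open>p(n + 1) - p(n)\<close> is the number of pairs of a word
  of length \<open>n\<close> and a vertex that ends a trajectory with this code. Backwards in time, these are the words of
  length \<open>n\<close> of the trajectories that start in a vertex. The same argument for the trajectories from a
  fixed vertex shows that their number grows with \<open>n\<close> by the number of generalized diagonals with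
  \<open>n + 1\<close> links; hence it is \<open>N\<^sub>c(n)\<close>. Finally, a trajectory that extends to an infinite
  orbit is found by a parallel translation that avoids countably many bad values.\<close>

subsection \<open>Cutting a convex set by disjoint hyperplanes\<close>

text \<open>Directions are not normalised: a line is any pair of a direction and an offset. Thus
  passing through a given point is one linear condition, reflections act linearly, and the
  trajectories with a given code form a convex cone. The count of extensions must run for two kinds
  of cones. Those of trajectories entering through a side are open, so at a vertex ahead a parallel
  translation crosses the cutting hyperplane. Those of trajectories from a vertex lie in the
  hyperplane of the lines through its unfolded image. There only rotations about this image are
  available, and they would not move the line off a vertex that coincides with the image. To rule
  out this focal case, the unfolded image is followed through the bounces and kept behind the moving
  point. The recursion starts from p(1) = N_c(0), that is, from as many sides as vertices, and this
  too is read off from the count, applied to all lines entering through one side.\<close>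

lemma convex_sign_change:
  fixes f :: "'e::real_vector \<Rightarrow> real"
  assumes "linear f" "convex C" "x \<in> C" "y \<in> C" "f x < 0" "f y > 0"
  obtains z where "z \<in> C" "f z = 0"
proof -
  define t where "t = f y / (f y - f x)"
  have t: "0 \<le> t" "0 \<le> 1 - t" using assms by (auto simp: t_def divide_simps)
  have "t *\<^sub>R x + (1 - t) *\<^sub>R y \<in> C"
    using assms t by (intro convexD) auto
  moreover have "f (t *\<^sub>R x + (1 - t) *\<^sub>R y) = f y - t * (f y - f x)"
    using \<open>linear f\<close> by (simp only: linear_add linear_scale) (simp add: algebra_simps)
  then have "f (t *\<^sub>R x + (1 - t) *\<^sub>R y) = 0"
    using assms by (simp add: t_def)
  ultimately show ?thesis using that by blast
qed

lemma open_perturb: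
  fixes l m :: "'b::real_normed_vector"
  assumes "open A" "l \<in> A"
  shows "\<exists>\<epsilon>>0. \<forall>t. \<bar>t\<bar> < \<epsilon> \<longrightarrow> l + t *\<^sub>R m \<in> A"
proof -
  obtain \<delta> where \<delta>: "\<delta> > 0" "ball l \<delta> \<subseteq> A" using assms open_contains_ball by blast
  \<comment> \<open>The summand 1 keeps the denominator positive when \<open>m = 0\<close>.\<close>
  have "l + t *\<^sub>R m \<in> A" if "\<bar>t\<bar> < \<delta> / (norm m + 1)" for t
  proof -
    have "\<bar>t\<bar> * (norm m + 1) < \<delta>" using that by (simp add: pos_less_divide_eq add_nonneg_pos)
    then have "norm (t *\<^sub>R m) < \<delta>" by (simp add: algebra_simps)
    then show ?thesis using \<delta>(2) by (auto simp: dist_norm)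
  qed
  then show ?thesis using \<delta>(1) by (intro exI[of _ "\<delta> / (norm m + 1)"]) (auto simp: add_nonneg_pos)
qed

text \<open>Both images are the same quotient of \<open>A\<close>. This transfers a count of sign
  patterns to a count of exit sides.\<close>

lemma card_image_same_kernel:
  assumes "\<And>x y. x \<in> A \<Longrightarrow> y \<in> A \<Longrightarrow> f x = f y \<longleftrightarrow> g x = g y"
  shows "card (f ` A) = card (g ` A)"
proof (rule bij_betw_same_card)
  show "bij_betw (\<lambda>z. g (inv_into A f z)) (f ` A) (g ` A)"
    unfolding bij_betw_def
  proof
    show "inj_on (\<lambda>z. g (inv_into A f z)) (f ` A)"
      by (rule inj_onI) (metis assms f_inv_into_f inv_into_into)
    show "(\<lambda>z. g (inv_into A f z)) ` f ` A = g ` A"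
      unfolding image_image
      by (rule image_cong[OF refl]) (metis assms f_inv_into_f inv_into_into imageI)
  qed
qed

text \<open>Cut \<open>C\<close> along one hyperplane at a time: as the others do not meet it inside \<open>C\<close>, each of
  them meets exactly one of the two halves.\<close>

lemma card_regions:
  fixes f :: "'i \<Rightarrow> 'e::real_vector \<Rightarrow> real"
  assumes "finite V" "\<And>v. v \<in> V \<Longrightarrow> linear (f v)" "convex C" "C \<noteq> {}"
    and "\<And>v v' x. v \<in> V \<Longrightarrow> v' \<in> V \<Longrightarrow> v \<noteq> v' \<Longrightarrow> x \<in> C \<Longrightarrow> f v x = 0 \<Longrightarrow> f v' x \<noteq> 0"
    and "\<And>v x. v \<in> V \<Longrightarrow> x \<in> C \<Longrightarrow> f v x = 0 \<Longrightarrow>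
           \<exists>m \<epsilon>. f v m \<noteq> 0 \<and> 0 < \<epsilon> \<and> (\<forall>t. \<bar>t\<bar> < \<epsilon> \<longrightarrow> x + t *\<^sub>R m \<in> C)"
  shows "card ((\<lambda>x. {v \<in> V. f v x > 0}) ` {x \<in> C. \<forall>v\<in>V. f v x \<noteq> 0})
           = Suc (card {v \<in> V. \<exists>x\<in>C. f v x = 0})"
  using assms
proof (induction V arbitrary: C rule: finite_induct)
  case empty
  then have "(\<lambda>x. {v \<in> {}. f v x > 0}) ` {x \<in> C. \<forall>v\<in>{}. f v x \<noteq> 0} = {{}}" by auto
  then show ?case by simp
next
  case (insert u V)
  note lin = insert.prems(1) and conv = insert.prems(2) and ne = insert.prems(3)
    and disj = insert.prems(4) and pert = insert.prems(5)
  have linu: "linear (f u)" using lin by simp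
  define reg where "reg C = (\<lambda>x. {v \<in> V. f v x > 0}) ` {x \<in> C. \<forall>v\<in>V. f v x \<noteq> 0}" for C
  define hit where "hit C = {v \<in> V. \<exists>x\<in>C. f v x = 0}" for C
  define Cp where "Cp = {x \<in> C. f u x > 0}"
  define Cn where "Cn = {x \<in> C. f u x < 0}"
  have fin: "finite (reg D)" "finite (hit D)" for D
    using insert.hyps(1) by (auto simp: reg_def hit_def intro: finite_subset[of _ "Pow V"])
  have halfspaces: "convex {x. f u x > 0}" "convex {x. f u x < 0}"
    using linu by (auto intro!: convexI simp: linear_add linear_scale)
       (smt (verit) mult_nonneg_nonneg mult_pos_pos mult_nonneg_nonpos mult_pos_neg)+
  \<comment> \<open>The sign \<open>s\<close> lets one application of the induction hypothesis serve
    both halves.\<close>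
  have half: "card (reg D) = Suc (card (hit D))"
    if D: "D = {x \<in> C. s * f u x > 0}" "D \<noteq> {}" "s = 1 \<or> s = -1" for s D
  proof -
    have "D = C \<inter> {x. f u x > 0} \<or> D = C \<inter> {x. f u x < 0}" using D by auto
    then have "convex D" using conv halfspaces by (auto intro: convex_Int)
    show ?thesis unfolding reg_def hit_def
    proof (rule insert.IH)
      fix v x assume v: "v \<in> V" and x: "x \<in> D" and z: "f v x = 0"
      then obtain m \<epsilon> where m: "f v m \<noteq> 0" "0 < \<epsilon>" "\<And>t. \<bar>t\<bar> < \<epsilon> \<Longrightarrow> x + t *\<^sub>R m \<in> C"
        using pert[of v x] D by auto
      \<comment> \<open>Shrunk so that \<open>f u\<close> keeps its sign along the perturbation,
        whence the half inherits the transversality. As only one direction across each hyperplane is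
        asked for, \<open>C\<close> may lie in a proper subspace, as the cones of trajectories from
        a vertex do.\<close>
      define \<delta> where "\<delta> = min \<epsilon> (s * f u x / (\<bar>f u m\<bar> + 1))"
      have "\<delta> > 0" using D(1) x m by (auto simp: \<delta>_def divide_simps)
      moreover have "x + t *\<^sub>R m \<in> D" if t: "\<bar>t\<bar> < \<delta>" for t
      proof -
        have "\<bar>t\<bar> * (\<bar>f u m\<bar> + 1) < s * f u x"
          using t by (simp add: \<delta>_def pos_less_divide_eq add_nonneg_pos)
        then have "\<bar>t * f u m\<bar> < s * f u x" by (simp add: abs_mult algebra_simps)
        then have "s * f u (x + t *\<^sub>R m) > 0"
          using D(3) linu by (auto simp: linear_add linear_scale)
        then show ?thesis using m(3) t D(1) by (auto simp: \<delta>_def)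
      qed
      ultimately show "\<exists>m \<epsilon>. f v m \<noteq> 0 \<and> 0 < \<epsilon> \<and> (\<forall>t. \<bar>t\<bar> < \<epsilon> \<longrightarrow> x + t *\<^sub>R m \<in> D)"
        using m(1) by blast
    qed (use \<open>convex D\<close> D lin disj in auto)
  qed
  have neg_reg: "(\<lambda>x. {v \<in> insert u V. f v x > 0}) ` {x \<in> C. \<forall>v\<in>insert u V. f v x \<noteq> 0}
      = insert u ` reg Cp \<union> reg Cn"
    (is "?reg = _")
  proof
    show "?reg \<subseteq> insert u ` reg Cp \<union> reg Cn"
    proof
      fix X assume "X \<in> ?reg"
      then obtain x where x: "x \<in> C" "\<forall>v\<in>insert u V. f v x \<noteq> 0" "X = {v \<in> insert u V. f v x > 0}"
        by auto
      show "X \<in> insert u ` reg Cp \<union> reg Cn"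
      proof (cases "f u x > 0")
        case True
        then have "X = insert u {v \<in> V. f v x > 0}" using x by auto
        then show ?thesis using x True by (auto simp: reg_def Cp_def)
      next
        case False
        then have "X = {v \<in> V. f v x > 0}" using x by auto
        moreover have "x \<in> Cn" using x False by (auto simp: Cn_def)
        ultimately show ?thesis using x by (auto simp: reg_def)
      qed
    qed
    show "insert u ` reg Cp \<union> reg Cn \<subseteq> ?reg"
    proof
      fix X assume "X \<in> insert u ` reg Cp \<union> reg Cn"
      then consider x where "x \<in> Cp" "\<forall>v\<in>V. f v x \<noteq> 0" "X = insert u {v \<in> V. f v x > 0}"
        | x where "x \<in> Cn" "\<forall>v\<in>V. f v x \<noteq> 0" "X = {v \<in> V. f v x > 0}"
        by (auto simp: reg_def)
      then show "X \<in> ?reg"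
      proof cases
        case (1 x)
        then have "X = {v \<in> insert u V. f v x > 0}" by (auto simp: Cp_def)
        then show ?thesis using 1 by (auto simp: Cp_def)
      next
        case (2 x)
        then have "X = {v \<in> insert u V. f v x > 0}" by (auto simp: Cn_def)
        then show ?thesis using 2 by (auto simp: Cn_def)
      qed
    qed
  qed
  have unotin: "u \<notin> X" if "X \<in> reg D" for X D using that insert.hyps(2) by (auto simp: reg_def)
  have inj: "inj_on (insert u) (reg D)" for D
    by (rule inj_onI) (metis unotin insert_ident)
  have card_reg: "card ?reg = card (reg Cp) + card (reg Cn)"
    unfolding neg_reg using fin inj
    by (subst card_Un_disjoint) (use unotin[of _ Cn] in \<open>auto simp: card_image\<close>)
  have regempty: "reg {} = {}" by (simp add: reg_def)
  have hitempty: "hit {} = {}" by (simp add: hit_def)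
  show ?case
  proof (cases "\<exists>x\<in>C. f u x = 0")
    case False
    have hits: "{v \<in> insert u V. \<exists>x\<in>C. f v x = 0} = hit C" using False by (auto simp: hit_def)
    have "Cp = {} \<or> Cn = {}"
      using convex_sign_change[OF linu conv] False unfolding Cp_def Cn_def by blast
    moreover have "C = Cp \<union> Cn" using False by (auto simp: Cp_def Cn_def)
    ultimately consider "Cp = C" "Cn = {}" | "Cn = C" "Cp = {}"
      by blast
    then show ?thesis
    proof cases
      case 1
      then show ?thesis using card_reg hits half[of Cp 1] ne regempty by (simp add: Cp_def)
    next
      case 2
      then show ?thesis using card_reg hits half[of Cn "-1"] ne regempty by (simp add: Cn_def)
    qed
  next
    case True
    then obtain x where x: "x \<in> C" "f u x = 0" by auto
    then obtain m \<epsilon> where m: "f u m \<noteq> 0" "0 < \<epsilon>" "\<And>t. \<bar>t\<bar> < \<epsilon> \<Longrightarrow> x + t *\<^sub>R m \<in> C"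
      using pert[of u x] by auto
    \<comment> \<open>The sign makes \<open>f u\<close> positive at the point displaced by
      \<open>t\<close> and negative at the one displaced by \<open>- t\<close>, so both halves are
      nonempty.\<close>
    define t where "t = (\<epsilon> / 2) * sgn (f u m)"
    have t: "\<bar>t\<bar> < \<epsilon>" "\<bar>-t\<bar> < \<epsilon>" "t * f u m > 0"
      using m(1,2) by (auto simp: t_def sgn_if mult_pos_neg)
    have "x + t *\<^sub>R m \<in> Cp" "x + (-t) *\<^sub>R m \<in> Cn"
      using m(3)[OF t(1)] m(3)[OF t(2)] t(3) x linu
      by (auto simp: Cp_def Cn_def linear_add linear_scale linear_diff)
    then have "Cp \<noteq> {}" "Cn \<noteq> {}" by auto
    then have cards: "card (reg Cp) = Suc (card (hit Cp))" "card (reg Cn) = Suc (card (hit Cn))"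
      using half[of Cp 1] half[of Cn "-1"] by (auto simp: Cp_def Cn_def)
    \<comment> \<open>If \<open>f v\<close> vanished in both halves, \<open>f u\<close> would change
      sign on the convex slice where \<open>f v\<close> vanishes, so both would vanish at one point
      of \<open>C\<close>.\<close>
    have "hit Cp \<inter> hit Cn = {}"
    proof (rule ccontr)
      assume "hit Cp \<inter> hit Cn \<noteq> {}"
      then obtain v y z where v: "v \<in> V" "y \<in> C" "f u y > 0" "f v y = 0" "z \<in> C" "f u z < 0" "f v z = 0"
        by (auto simp: hit_def Cp_def Cn_def)
      have lv: "linear (f v)" using lin v by auto
      have "convex (C \<inter> {x. f v x = 0})"
        using conv by (intro convex_Int) (auto intro!: convexI simp: linear_add[OF lv] linear_scale[OF lv])
      from convex_sign_change[OF linu this, of z y] obtain q where "q \<in> C" "f v q = 0" "f u q = 0"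
        using v by auto
      then show False using disj[of v u q] v(1) insert.hyps(2) by auto
    qed
    moreover have "{v \<in> insert u V. \<exists>x\<in>C. f v x = 0} = insert u (hit Cp \<union> hit Cn)"
    proof -
      have "v \<in> hit Cp \<union> hit Cn" if "v \<in> V" "y \<in> C" "f v y = 0" for v y
      proof -
        have "f u y \<noteq> 0" using disj[of v u y] that insert.hyps(2) by auto
        then show ?thesis using that by (cases "f u y > 0") (auto simp: hit_def Cp_def Cn_def)
      qed
      then show ?thesis using True by (auto simp: hit_def Cp_def Cn_def)
    qed
    ultimately have "card {v \<in> insert u V. \<exists>x\<in>C. f v x = 0} = Suc (card (hit Cp) + card (hit Cn))"
      using fin insert.hyps by (simp add: card_Un_disjoint hit_def)
    then show ?thesis using card_reg cards by simp
  qed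
qed

subsection \<open>Reflections and oriented lines in the plane\<close>

definition cross2 :: "plane \<Rightarrow> plane \<Rightarrow> real" where
  "cross2 u v = u $ 1 * v $ 2 - u $ 2 * v $ 1"

lemma cross2_simps [simp]:
  "cross2 (u + v) w = cross2 u w + cross2 v w" "cross2 w (u + v) = cross2 w u + cross2 w v"
  "cross2 (u - v) w = cross2 u w - cross2 v w" "cross2 w (u - v) = cross2 w u - cross2 w v"
  "cross2 (r *\<^sub>R u) w = r * cross2 u w" "cross2 w (r *\<^sub>R u) = r * cross2 w u"
  "cross2 (- u) w = - cross2 u w" "cross2 w (- u) = - cross2 w u"
  "cross2 u u = 0" "cross2 0 u = 0" "cross2 u 0 = 0"
  by (auto simp: cross2_def algebra_simps)

lemma cross2_swap: "cross2 u v = - cross2 v u"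
  by (simp add: cross2_def)

lemma inner_plane: "u \<bullet> v = u $ 1 * v $ 1 + u $ 2 * v $ 2" for u v :: plane
  by (simp add: inner_vec_def sum_2)

lemma plane_eq_iff: "u = v \<longleftrightarrow> u $ 1 = v $ 1 \<and> u $ 2 = v $ 2" for u v :: plane
  by (simp add: vec_eq_iff forall_2)

lemma cross2_eq_0E:
  assumes "cross2 d v = 0" "d \<noteq> 0"
  obtains s where "v = s *\<^sub>R d"
proof -
  have "d \<bullet> d \<noteq> 0" using assms by simp
  then have "v = ((v \<bullet> d) / (d \<bullet> d)) *\<^sub>R d"
    using assms(1) by (simp add: plane_eq_iff inner_plane cross2_def field_simps)
  then show ?thesis using that by blast
qed

definition normal :: "plane \<Rightarrow> plane" where
  "normal e = vector [- e $ 2, e $ 1]"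

lemma normal_nth [simp]: "normal e $ 1 = - e $ 2" "normal e $ 2 = e $ 1"
  by (simp_all add: normal_def)

lemma inner_normal: "normal e \<bullet> v = cross2 e v"
  by (simp add: inner_plane cross2_def)

lemma cross2_normal: "cross2 u (normal e) = u \<bullet> e"
  by (simp add: inner_plane cross2_def)

lemma normal_eq_0 [simp]: "normal e = 0 \<longleftrightarrow> e = 0"
  by (auto simp: plane_eq_iff)

definition mirror :: "plane \<Rightarrow> plane \<Rightarrow> plane" where
  "mirror e = reflect (normal e)"

lemma mirror_linear: "linear (mirror e)"
  by (rule linearI) (simp_all add: mirror_def reflect_def inner_add_left add_divide_distrib algebra_simps)

lemma mirror_diff [simp]: "mirror e (u - v) = mirror e u - mirror e v"
  and mirror_scale [simp]: "mirror e (r *\<^sub>R u) = r *\<^sub>R mirror e u"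
  and mirror_minus [simp]: "mirror e (- u) = - mirror e u"
  by (simp_all add: linear_diff[OF mirror_linear] linear_scale[OF mirror_linear] linear_neg[OF mirror_linear])

lemma mirror_mirror [simp]: "mirror e (mirror e v) = v"
  by (cases "e = 0") (auto simp: mirror_def reflect_def inner_diff_left)

lemma mirror_self [simp]: "mirror e e = e"
  by (simp add: mirror_def reflect_def inner_commute[of e] inner_normal)

lemma inner_mirror [simp]: "mirror e u \<bullet> mirror e v = u \<bullet> v"
  by (cases "e = 0") (auto simp: mirror_def reflect_def inner_diff_left inner_diff_right inner_commute)

lemma norm_mirror [simp]: "norm (mirror e v) = norm v"
  by (simp add: norm_eq_sqrt_inner)

lemma mirror_sgn: "mirror e (sgn v) = sgn (mirror e v)"
  by (simp add: sgn_div_norm)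

text \<open>A reflection has determinant -1; this sign is why a bounce swaps the left and the right
  of a line.\<close>

lemma cross2_mirror [simp]:
  assumes "e \<noteq> 0"
  shows "cross2 (mirror e u) (mirror e v) = - cross2 u v"
proof -
  have *: "normal e \<bullet> normal e \<noteq> 0" using assms by simp
  define N where "N = normal e \<bullet> normal e"
  have "cross2 (mirror e u) (mirror e v) = cross2 u v
      - (2 * (u \<bullet> normal e) * cross2 (normal e) v + 2 * (v \<bullet> normal e) * cross2 u (normal e)) / N"
    by (simp add: mirror_def reflect_def N_def algebra_simps add_divide_distrib)
  also have "2 * (u \<bullet> normal e) * cross2 (normal e) v + 2 * (v \<bullet> normal e) * cross2 u (normal e)
      = 2 * cross2 u v * N"
    by (simp add: N_def inner_plane cross2_def algebra_simps)
  finally show ?thesis using * by (simp add: N_def)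
qed

text \<open>The normals of a line in the plane are multiples of each other, and scaling the normal
  does not change the reflection. So the arbitrary normal in \<open>bounce\<close> can be replaced
  by a canonical one.\<close>

lemma reflect_eq_mirror:
  assumes "orthogonal n e" "n \<noteq> 0" "e \<noteq> 0"
  shows "reflect n = mirror e"
proof -
  have "cross2 (normal e) n = 0"
    using assms(1) cross2_swap[of n "normal e"] by (simp add: cross2_normal orthogonal_def)
  then obtain s where s: "n = s *\<^sub>R normal e"
    using cross2_eq_0E[of "normal e" n] assms by auto
  moreover have "s \<noteq> 0" using s assms by auto
  ultimately show ?thesis by (auto simp: mirror_def reflect_def fun_eq_iff)
qed

text \<open>An oriented line is a pair \<open>(d, c)\<close>: it has direction \<open>d\<close> and consists of the zeros of
  \<open>off (d, c)\<close>, which is positive to the left of the line and depends linearly on \<open>(d, c)\<close>.\<close>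

definition off :: "plane \<times> real \<Rightarrow> plane \<Rightarrow> real" where
  "off l p = cross2 (fst l) p + snd l"

definition line :: "plane \<Rightarrow> plane \<Rightarrow> plane \<times> real" where
  "line x d = (d, - cross2 d x)"

lemma fst_line [simp]: "fst (line x d) = d"
  by (simp add: line_def)

lemma off_line: "off (line x d) p = cross2 d (p - x)"
  by (simp add: off_def line_def)

lemma off_linear: "linear (\<lambda>l. off l p)"
  by (rule linearI) (auto simp: off_def algebra_simps)

lemma off_simps [simp]:
  "off (l + m) p = off l p + off m p" "off (r *\<^sub>R l) p = r * off l p" "off (- l) p = - off l p"
  by (auto simp: off_def algebra_simps)

lemma continuous_cross2 [continuous_intros]:
  "continuous_on A f \<Longrightarrow> continuous_on A g \<Longrightarrow> continuous_on A (\<lambda>x. cross2 (f x) (g x))"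
  unfolding cross2_def by (intro continuous_intros)

lemma continuous_off [continuous_intros]:
  "continuous_on A f \<Longrightarrow> continuous_on A (\<lambda>x. off (f x) p)"
  unfolding off_def by (intro continuous_intros)

lemma off_zeroE:
  assumes "off l x = 0" "off l y = 0" "fst l \<noteq> 0"
  obtains s where "y = x + s *\<^sub>R fst l"
proof -
  have "cross2 (fst l) (y - x) = 0" using assms by (simp add: off_def)
  then obtain s where "y - x = s *\<^sub>R fst l" using cross2_eq_0E assms by blast
  then show ?thesis using that[of s] by (simp add: algebra_simps)
qed

text \<open>Once the direction is fixed, one offset fixes the line; identities between reflected
  lines are therefore checked at a single convenient point.\<close>

lemma state_eqI: "fst l = fst m \<Longrightarrow> off l p = off m p \<Longrightarrow> l = m"
  by (simp add: off_def prod_eq_iff)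

subsection \<open>Convex polygons\<close>

locale polygon =
  fixes Q :: "plane set"
  assumes polygon: "convex_polygon Q"
begin

lemma polytope: "polytope Q"
  and interior_nonempty: "interior Q \<noteq> {}"
  using polygon by (auto simp: convex_polygon_def)

lemma compact: "compact Q" and convex: "convex Q" and closed: "closed Q" and polyhedron: "polyhedron Q"
  using polytope by (auto intro: polytope_imp_compact polytope_imp_convex polytope_imp_closed polytope_imp_polyhedron)

lemma finite_vertices: "finite (vertices Q)"
  unfolding vertices_def by (rule finite_polyhedron_extreme_points[OF polyhedron])

lemma finite_sides: "finite (sides Q)"
  by (rule finite_subset[OF _ finite_polytope_faces[OF polytope]]) (auto simp: sides_def edge_of_def)

lemma side_face: "S \<in> sides Q \<Longrightarrow> S face_of Q"
  by (simp add: sides_def edge_of_def)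

lemma aff_dim_Q: "aff_dim Q = 2"
  using interior_nonempty by (simp add: aff_dim_nonempty_interior)

lemma frontier_subset: "frontier Q \<subseteq> Q"
  using closed by (simp add: frontier_def)

lemma frontier_not_interior: "x \<in> frontier Q \<Longrightarrow> x \<notin> interior Q"
  by (simp add: frontier_def)

lemma frontier_eq_sides: "frontier Q = \<Union> (sides Q)"
proof -
  have "rel_frontier Q = frontier Q"
    using interior_nonempty by (simp add: rel_frontier_nonempty_interior)
  moreover have "{F. F facet_of Q} = sides Q"
    by (auto simp: facet_of_def sides_def edge_of_def aff_dim_Q)
  ultimately show ?thesis using rel_frontier_of_polyhedron[OF polyhedron] by simp
qed

lemma vertices_subset_frontier: "vertices Q \<subseteq> frontier Q"
  using closed extreme_point_not_in_interior
  by (auto simp: vertices_def frontier_def extreme_point_of_def)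

text \<open>A side is an exposed face, so its supporting line has the polygon on one side. Naming
  the endpoints in the right order puts the polygon to the left. They are packed into a pair so that
  \<open>ends\<close> needs only one choice.\<close>

lemma side_endpoints:
  assumes "S \<in> sides Q"
  shows "\<exists>ab. fst ab \<noteq> snd ab \<and> S = closed_segment (fst ab) (snd ab) \<and> fst ab \<in> vertices Q \<and>
    snd ab \<in> vertices Q \<and> (\<forall>q\<in>Q - S. 0 < cross2 (snd ab - fst ab) (q - fst ab))"
proof -
  have S: "S face_of Q" "aff_dim S = 1" using assms by (auto simp: sides_def edge_of_def)
  have "compact S" "convex S"
    using S(1) convex compact face_of_imp_compact face_of_imp_convex by blast+
  moreover have "S \<noteq> {}" "collinear S" using S(2) by (auto simp: collinear_aff_dim)
  ultimately obtain a b where ab: "S = closed_segment a b"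
    using compact_convex_collinear_segment by blast
  have "a \<noteq> b" using S(2) ab by auto
  have vert: "a \<in> vertices Q" "b \<in> vertices Q"
    using extreme_point_of_face[OF S(1)] by (auto simp: vertices_def ab extreme_point_of_segment)
  have "S exposed_face_of Q" "S \<noteq> Q"
    using S exposed_face_of_polyhedron[OF polyhedron] aff_dim_Q by auto
  then obtain n c where n: "n \<noteq> 0" "Q \<subseteq> {x. n \<bullet> x \<le> c}" "S = Q \<inter> {x. n \<bullet> x = c}"
    using \<open>S \<noteq> {}\<close> unfolding exposed_face_of by auto
  have nab: "n \<bullet> a = c" "n \<bullet> b = c" using n(3) ab by auto
  then have "cross2 (normal (b - a)) n = 0"
    using cross2_swap[of n "normal (b - a)"] by (simp add: cross2_normal inner_diff_right)
  then obtain s where s: "n = s *\<^sub>R normal (b - a)"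
    using cross2_eq_0E \<open>a \<noteq> b\<close> by (metis normal_eq_0 right_minus_eq)
  have neg: "s * cross2 (b - a) (q - a) < 0" if "q \<in> Q - S" for q
  proof -
    have "n \<bullet> (q - a) < 0" using that n nab by (force simp: inner_diff_right)
    then show ?thesis by (simp add: s inner_normal)
  qed
  have "s \<noteq> 0" using n(1) s by auto
  show ?thesis
  proof (cases "s < 0")
    case True
    then have "\<forall>q\<in>Q - S. 0 < cross2 (b - a) (q - a)"
      using neg by (metis mult_less_0_iff less_asym)
    then show ?thesis using \<open>a \<noteq> b\<close> ab vert by (intro exI[of _ "(a, b)"]) auto
  next
    case False
    have "0 < cross2 (a - b) (q - b)" if "q \<in> Q - S" for q
    proof -
      have "cross2 (a - b) (q - b) = - cross2 (b - a) (q - a)"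
        using cross2_swap[of a b] by simp
      then show ?thesis using neg[OF that] False \<open>s \<noteq> 0\<close> by (simp add: mult_less_0_iff)
    qed
    then show ?thesis using \<open>a \<noteq> b\<close> ab vert
      by (intro exI[of _ "(b, a)"]) (auto simp: closed_segment_commute)
  qed
qed

definition ends :: "plane set \<Rightarrow> plane \<times> plane" where
  "ends S = (SOME ab. fst ab \<noteq> snd ab \<and> S = closed_segment (fst ab) (snd ab) \<and> fst ab \<in> vertices Q \<and>
    snd ab \<in> vertices Q \<and> (\<forall>q\<in>Q - S. 0 < cross2 (snd ab - fst ab) (q - fst ab)))"

text \<open>The endpoints of a side as seen by a point that enters the polygon through it.\<close>

definition lend :: "plane set \<Rightarrow> plane" where "lend S = fst (ends S)"
definition rend :: "plane set \<Rightarrow> plane" where "rend S = snd (ends S)"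

lemma
  assumes "S \<in> sides Q"
  shows ends_neq: "lend S \<noteq> rend S"
    and side_eq: "S = closed_segment (lend S) (rend S)"
    and lend_vertex: "lend S \<in> vertices Q"
    and rend_vertex: "rend S \<in> vertices Q"
    and side_pos: "q \<in> Q \<Longrightarrow> q \<notin> S \<Longrightarrow> 0 < cross2 (rend S - lend S) (q - lend S)"
  using someI_ex[OF side_endpoints[OF assms]] unfolding lend_def rend_def ends_def by blast+

lemma lend_in: "S \<in> sides Q \<Longrightarrow> lend S \<in> S" and rend_in: "S \<in> sides Q \<Longrightarrow> rend S \<in> S"
  by (metis side_eq ends_in_segment)+

lemma side_subset: "S \<in> sides Q \<Longrightarrow> S \<subseteq> Q"
  using side_face face_of_imp_subset by blast

lemma side_vertices: "S \<in> sides Q \<Longrightarrow> S \<inter> vertices Q = {lend S, rend S}"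
  using extreme_point_of_face[OF side_face] side_eq[of S] extreme_point_of_segment[of _ "lend S" "rend S"]
  unfolding vertices_def by auto

lemma open_side: "S \<in> sides Q \<Longrightarrow> S - vertices Q = open_segment (lend S) (rend S)"
  using side_vertices[of S] side_eq[of S] unfolding open_segment_def by auto

text \<open>A non-vertex lies strictly between the ends of its side, and a face that contains such a
  point contains both ends.\<close>

lemma side_unique:
  assumes "S \<in> sides Q" "T \<in> sides Q" "x \<in> S" "x \<in> T" "x \<notin> vertices Q"
  shows "S = T"
proof -
  have "S \<subseteq> T" if "S \<in> sides Q" "T \<in> sides Q" "x \<in> S" "x \<in> T" for S T
  proof -
    have "x \<in> open_segment (lend S) (rend S)" using open_side that assms(5) by blast
    then have "lend S \<in> T" "rend S \<in> T"
      using face_ofD[OF side_face[OF that(2)]] that lend_in rend_in side_subset by blast+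
    then show ?thesis
      using side_eq[OF that(1)] face_of_imp_convex[OF side_face[OF that(2)]] closed_segment_subset by metis
  qed
  then show ?thesis using assms by blast
qed

lemma off_side_diff: "off l (lend S) - off l (rend S) = cross2 (rend S - lend S) (fst l)"
  using cross2_swap[of "lend S" "fst l"] cross2_swap[of "rend S" "fst l"] by (simp add: off_def)

section \<open>Directions into the polygon and links\<close>

definition inward :: "plane \<Rightarrow> plane \<Rightarrow> bool" where
  "inward x d \<longleftrightarrow> (\<exists>t>0. x + t *\<^sub>R d \<in> interior Q)"

lemma inward_scale: "r > 0 \<Longrightarrow> inward x (r *\<^sub>R d) \<longleftrightarrow> inward x d"
proof
  assume "r > 0" "inward x (r *\<^sub>R d)"
  then obtain t where "t > 0" "x + t *\<^sub>R r *\<^sub>R d \<in> interior Q" by (auto simp: inward_def)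
  then show "inward x d" using \<open>r > 0\<close> unfolding inward_def by (intro exI[of _ "t * r"]) auto
next
  assume "r > 0" "inward x d"
  then obtain t where "t > 0" "x + t *\<^sub>R d \<in> interior Q" by (auto simp: inward_def)
  then show "inward x (r *\<^sub>R d)" using \<open>r > 0\<close> unfolding inward_def by (intro exI[of _ "t / r"]) auto
qed

lemma inward_nonzero: "x \<in> frontier Q \<Longrightarrow> inward x d \<Longrightarrow> d \<noteq> 0"
  using frontier_not_interior by (auto simp: inward_def)

lemma segment_interior: "p \<in> interior Q \<Longrightarrow> q \<in> Q \<Longrightarrow> open_segment p q \<subseteq> interior Q"
  using in_interior_closure_convex_segment[OF convex] closure_subset by blast

lemma inward_add:
  assumes "inward x d" "inward x e" "x \<in> Q" "r \<ge> 0" "s \<ge> 0" "r + s > 0"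
  shows "inward x (r *\<^sub>R d + s *\<^sub>R e)"
proof -
  obtain t u where t: "t > 0" "x + t *\<^sub>R d \<in> interior Q" and u: "u > 0" "x + u *\<^sub>R e \<in> interior Q"
    using assms by (auto simp: inward_def)
  \<comment> \<open>\<open>k\<close> normalises the weights: the point reached from \<open>x\<close>
    by \<open>1 / k\<close> times the combined direction is a convex combination of the two given
    interior points.\<close>
  define k where "k = r / t + s / u"
  have k: "k > 0" using assms t u by (auto simp: k_def add_nonneg_pos add_pos_nonneg)
      (smt (verit) divide_nonneg_pos divide_pos_pos)
  have "r / t / k + s / u / k = 1"
    using k by (simp only: add_divide_distrib[symmetric] k_def[symmetric]) simp
  then have "(r / t / k) *\<^sub>R (x + t *\<^sub>R d) + (s / u / k) *\<^sub>R (x + u *\<^sub>R e) \<in> interior Q"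
    using t u assms k by (intro convexD[OF convex_interior[OF convex]]) auto
  also have "(r / t / k) *\<^sub>R (x + t *\<^sub>R d) + (s / u / k) *\<^sub>R (x + u *\<^sub>R e)
      = ((r / t + s / u) / k) *\<^sub>R x + (1 / k) *\<^sub>R (r *\<^sub>R d + s *\<^sub>R e)"
    using t u by (simp add: algebra_simps add_divide_distrib)
  also have "\<dots> = x + (1 / k) *\<^sub>R (r *\<^sub>R d + s *\<^sub>R e)" using k by (simp flip: k_def)
  finally show ?thesis using k unfolding inward_def by (intro exI[of _ "1 / k"]) auto
qed

lemma inward_side:
  assumes S: "S \<in> sides Q" and x: "x \<in> S" "x \<notin> vertices Q"
  shows "inward x d \<longleftrightarrow> 0 < cross2 (rend S - lend S) d"
proof -
  define e where "e = rend S - lend S"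
  have "e \<noteq> 0" using ends_neq[OF S] by (simp add: e_def)
  have xo: "x \<in> open_segment (lend S) (rend S)" using open_side S x by blast
  then obtain u where u: "0 < u" "u < 1" "x = (1 - u) *\<^sub>R lend S + u *\<^sub>R rend S"
    by (auto simp: in_segment)
  then have xe: "x = lend S + u *\<^sub>R e" by (simp add: e_def algebra_simps)
  have notS: "p \<in> Q \<and> p \<notin> S" if "p \<in> interior Q" for p
    using that interior_subset frontier_eq_sides frontier_not_interior S by blast
  have pos: "0 < cross2 e (p - x)" if "p \<in> interior Q" for p
    using side_pos[OF S, of p] notS[OF that] by (simp add: xe flip: e_def)
  show ?thesis
  proof
    assume "inward x d"
    then obtain t where "t > 0" "x + t *\<^sub>R d \<in> interior Q" by (auto simp: inward_def)
    then show "0 < cross2 (rend S - lend S) d"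
      using pos[of "x + t *\<^sub>R d"] by (simp add: zero_less_mult_iff flip: e_def)
  next
    assume "0 < cross2 (rend S - lend S) d"
    then have d: "0 < cross2 e d" by (simp add: e_def)
    obtain p where p: "p \<in> interior Q" using interior_nonempty by blast
    define a where "a = cross2 e d / cross2 e (p - x)"
    have a: "a > 0" using d pos[OF p] by (simp add: a_def)
    have "cross2 e (d - a *\<^sub>R (p - x)) = 0" using pos[OF p] by (simp add: a_def del: cross2_simps(4))
       (simp add: field_simps)
    then obtain b where b: "d - a *\<^sub>R (p - x) = b *\<^sub>R e"
      using cross2_eq_0E \<open>e \<noteq> 0\<close> by blast
    \<comment> \<open>The point reached at time \<open>t\<close> is to be a convex combination of
      the interior point \<open>p\<close>, with weight \<open>t * a\<close>, and of the point
      \<open>y\<close> of the side that is displaced from \<open>x\<close> by \<open>w\<close> times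
      \<open>e\<close>. The first bound gives \<open>t * a \<le> 1/2\<close>; the second keeps
      \<open>y\<close> on the side, where \<open>x\<close> has the parameter
      \<open>u\<close>.\<close>
    define t where "t = min (1 / (2 * a)) (min u (1 - u) / (2 * (\<bar>b\<bar> + 1)))"
    have t: "t > 0" using a u by (simp add: t_def)
    have ta: "t * a \<le> 1/2" using a by (auto simp: t_def min_def field_simps)
    have "t \<le> min u (1 - u) / (2 * (\<bar>b\<bar> + 1))" unfolding t_def by (rule min.cobounded2)
    then have "t * (2 * (\<bar>b\<bar> + 1)) \<le> min u (1 - u)" by (subst (asm) pos_le_divide_eq) auto
    then have tb: "t * \<bar>b\<bar> < min u (1 - u) / 2" using t by (simp add: algebra_simps)
    define w where "w = t * b / (1 - t * a)"
    have "\<bar>w\<bar> \<le> t * \<bar>b\<bar> / (1/2)"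
      unfolding w_def abs_divide abs_mult using t ta by (intro frac_le) auto
    then have w: "\<bar>w\<bar> < min u (1 - u)" using tb by simp
    define y where "y = x + w *\<^sub>R e"
    have "y = (1 - (u + w)) *\<^sub>R lend S + (u + w) *\<^sub>R rend S" by (simp add: y_def xe e_def algebra_simps)
    moreover have "0 \<le> u + w" "u + w \<le> 1" using w by auto
    ultimately have "y \<in> closed_segment (lend S) (rend S)" unfolding in_segment by blast
    then have "y \<in> S" using side_eq[OF S] by blast
    then have yQ: "y \<in> Q" using side_subset S by blast
    have "x + t *\<^sub>R d = (1 - t * a) *\<^sub>R y + (t * a) *\<^sub>R p"
    proof -
      have "(1 - t * a) *\<^sub>R y = (1 - t * a) *\<^sub>R x + (t * b) *\<^sub>R e"
      proof -
        have "(1 - t * a) * w = t * b" using ta by (simp add: w_def)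
        then show ?thesis unfolding y_def scaleR_add_right scaleR_scaleR by simp
      qed
      moreover have "d = a *\<^sub>R (p - x) + b *\<^sub>R e" using b by (simp add: algebra_simps)
      then have "t *\<^sub>R d = (t * a) *\<^sub>R (p - x) + (t * b) *\<^sub>R e"
        by (metis scaleR_add_right scaleR_scaleR)
      ultimately show ?thesis
        by (simp only:) (simp add: algebra_simps)
    qed
    moreover have "p \<noteq> y" using notS[OF p] \<open>y \<in> S\<close> by auto
    ultimately have "x + t *\<^sub>R d \<in> open_segment y p"
      using t a ta by (auto simp: in_segment intro!: exI[of _ "t * a"])
    then have "x + t *\<^sub>R d \<in> interior Q"
      using segment_interior[OF p yQ] by (auto simp: open_segment_commute)
    then show "inward x d" using t by (auto simp: inward_def)
  qed
qed

lemma link_sym: "billiard_link Q x y \<longleftrightarrow> billiard_link Q y x"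
  by (auto simp: billiard_link_def open_segment_commute)

lemma link_inward:
  assumes "billiard_link Q x y"
  shows "inward x (y - x)"
proof -
  have "midpoint x y \<in> open_segment x y" using assms by (simp add: billiard_link_def)
  moreover have "midpoint x y = x + (1/2) *\<^sub>R (y - x)"
    by (simp add: midpoint_def plane_eq_iff field_simps)
  ultimately have "x + (1/2) *\<^sub>R (y - x) \<in> interior Q"
    using assms by (auto simp: billiard_link_def)
  then show ?thesis unfolding inward_def by (intro exI[of _ "1/2"]) simp
qed

text \<open>The midpoint of a link is interior. By convexity, a further point of \<open>Q\<close> on
  the line beyond an end would make this end interior as well.\<close>

lemma link_frontier:
  assumes "billiard_link Q x z" "q \<in> frontier Q" "q = x + s *\<^sub>R (z - x)"
  shows "q = x \<or> q = z"
proof (rule ccontr)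
  assume ne: "\<not> (q = x \<or> q = z)"
  have *: "x \<in> frontier Q" "z \<in> frontier Q" "x \<noteq> z" "open_segment x z \<subseteq> interior Q"
    using assms by (auto simp: billiard_link_def)
  have mid: "midpoint x z \<in> interior Q" using * by (metis midpoint_in_open_segment subsetD)
  have q: "q \<in> Q" "q \<notin> interior Q" using assms(2) frontier_subset frontier_not_interior by auto
  have midq: "open_segment (midpoint x z) q \<subseteq> interior Q" using segment_interior[OF mid q(1)] .
  have "midpoint x z \<noteq> q" using mid q by auto
  consider "s = 0" | "s = 1" | "0 < s" "s < 1" | "s < 0" | "s > 1" by linarith
  then show False
  proof cases
    case 3
    then have "q \<in> open_segment x z"
      using assms(3) *(3) by (auto simp: in_segment algebra_simps intro!: exI[of _ s])
    then show ?thesis using * q by auto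
  next
    case 4
    \<comment> \<open>The weight at which the segment from the midpoint to \<open>q\<close> passes
      through \<open>x\<close>; in the last case the analogous weight gives
      \<open>z\<close>.\<close>
    define r where "r = 1 / (1 - 2 * s)"
    have r: "0 < r" "r < 1" "r * (1 - 2 * s) = 1" using 4 by (auto simp: r_def field_simps)
    have "x + (1/2 * (1 - r * (1 - 2 * s))) *\<^sub>R (z - x) = (1 - r) *\<^sub>R midpoint x z + r *\<^sub>R q"
      by (simp add: assms(3) midpoint_def plane_eq_iff field_simps)
    then have "x \<in> open_segment (midpoint x z) q"
      using r \<open>midpoint x z \<noteq> q\<close> by (auto simp: in_segment)
    then show ?thesis using midq * frontier_not_interior by blast
  next
    case 5
    define r where "r = 1 / (2 * s - 1)"
    have r: "0 < r" "r < 1" "r * (2 * s - 1) = 1" using 5 by (auto simp: r_def field_simps)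
    have "x + (1/2 * (1 + r * (2 * s - 1))) *\<^sub>R (z - x) = (1 - r) *\<^sub>R midpoint x z + r *\<^sub>R q"
      by (simp add: assms(3) midpoint_def plane_eq_iff field_simps)
    then have "z \<in> open_segment (midpoint x z) q"
      using r \<open>midpoint x z \<noteq> q\<close> by (auto simp: in_segment)
    then show ?thesis using midq * frontier_not_interior by blast
  qed (use assms(3) ne in auto)
qed

lemma exit_exists:
  assumes x: "x \<in> frontier Q" and d: "inward x d"
  obtains z s where "s > 0" "z = x + s *\<^sub>R d" "billiard_link Q x z"
proof -
  obtain t where t: "t > 0" "x + t *\<^sub>R d \<in> interior Q" using d by (auto simp: inward_def)
  define p where "p = x + t *\<^sub>R d"
  have d0: "d \<noteq> 0" using inward_nonzero x d by auto
  obtain s where s: "0 < s" "p + s *\<^sub>R d \<in> frontier Q" "\<And>e. 0 \<le> e \<Longrightarrow> e < s \<Longrightarrow> p + e *\<^sub>R d \<in> interior Q"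
    using ray_to_frontier[of Q p d] compact compact_imp_bounded t d0 by (auto simp: p_def)
  define z where "z = x + (t + s) *\<^sub>R d"
  have z: "z = p + s *\<^sub>R d" by (simp add: z_def p_def algebra_simps)
  have "open_segment x z \<subseteq> interior Q"
  proof
    fix q assume "q \<in> open_segment x z"
    then obtain u where u: "0 < u" "u < 1" "q = (1 - u) *\<^sub>R x + u *\<^sub>R z" by (auto simp: in_segment)
    define r where "r = u * (t + s)"
    have q: "q = x + r *\<^sub>R d" using u by (simp add: z_def r_def algebra_simps)
    have r: "0 < r" "r < t + s" using u t s by (auto simp: r_def)
    show "q \<in> interior Q"
    proof (cases "r < t")
      case True
      have "q = (1 - r / t) *\<^sub>R x + (r / t) *\<^sub>R p" using t by (simp add: q p_def algebra_simps)
      moreover have "x \<noteq> p" using t d0 by (simp add: p_def)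
      ultimately have "q \<in> open_segment x p" using True r t by (auto simp: in_segment intro!: exI[of _ "r / t"])
      then show ?thesis
        using segment_interior[of p x] t x frontier_subset by (auto simp: p_def open_segment_commute)
    next
      case False
      then show ?thesis using s(3)[of "r - t"] r by (simp add: q p_def algebra_simps)
    qed
  qed
  then have "billiard_link Q x z"
    using x s(1,2) z t d0 by (auto simp: billiard_link_def) (simp add: z_def)
  then show ?thesis using that[of "t + s" z] s t z_def by auto
qed

section \<open>Lines that enter the polygon\<close>

definition Enter :: "plane set \<Rightarrow> (plane \<times> real) set" where
  "Enter S = {l. off l (rend S) < 0 \<and> 0 < off l (lend S)}"

definition EnterV :: "plane \<Rightarrow> (plane \<times> real) set" where
  "EnterV v = {l. off l v = 0 \<and> inward v (fst l)}"

text \<open>Along the side \<open>off l\<close> is affine, so it has a zero strictly between the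
  ends when the signs there are opposite, and the order of the signs tells the direction of the
  crossing. The geometric condition thus becomes two strict linear inequalities, which are open and
  convex in \<open>l\<close>.\<close>

lemma Enter_iff:
  assumes "S \<in> sides Q"
  shows "l \<in> Enter S \<longleftrightarrow> (\<exists>x\<in>S - vertices Q. off l x = 0 \<and> inward x (fst l))"
proof
  assume l: "l \<in> Enter S"
  define u where "u = off l (lend S) / (off l (lend S) - off l (rend S))"
  have u: "0 < u" "u < 1" using l by (auto simp: Enter_def u_def field_simps)
  define x where "x = (1 - u) *\<^sub>R lend S + u *\<^sub>R rend S"
  have "x \<in> open_segment (lend S) (rend S)"
    using u ends_neq[OF assms] by (auto simp: in_segment x_def)
  then have x: "x \<in> S - vertices Q" using open_side[OF assms] by simp
  have "off l x = off l (lend S) - u * (off l (lend S) - off l (rend S))"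
    by (simp add: off_def x_def algebra_simps)
  also have "\<dots> = 0" using l by (simp add: u_def Enter_def)
  finally have "off l x = 0" .
  moreover have "inward x (fst l)"
    using inward_side[OF assms, of x "fst l"] x l off_side_diff[of l S] by (auto simp: Enter_def)
  ultimately show "\<exists>x\<in>S - vertices Q. off l x = 0 \<and> inward x (fst l)" using x by blast
next
  assume "\<exists>x\<in>S - vertices Q. off l x = 0 \<and> inward x (fst l)"
  then obtain x where x: "x \<in> S" "x \<notin> vertices Q" "off l x = 0" "inward x (fst l)" by blast
  then have "x \<in> open_segment (lend S) (rend S)" using open_side[OF assms] by blast
  then obtain u where u: "0 < u" "u < 1" "x = (1 - u) *\<^sub>R lend S + u *\<^sub>R rend S"
    by (auto simp: in_segment)
  have "0 < off l (lend S) - off l (rend S)"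
    unfolding off_side_diff using inward_side[OF assms] x by blast
  moreover have "off l x = off l (lend S) - u * (off l (lend S) - off l (rend S))"
    "off l x = off l (rend S) + (1 - u) * (off l (lend S) - off l (rend S))"
    by (simp_all add: off_def u(3) algebra_simps)
  ultimately show "l \<in> Enter S" using u x(3) by (auto simp: Enter_def mult_pos_pos)
     (smt (verit) mult_pos_pos)+
qed

text \<open>Leaving through a side is entering through it along the reversed line. This cannot
  happen at \<open>x\<close>, where the line itself points inward.\<close>

lemma exit_side:
  assumes S: "S \<in> sides Q" and l: "x \<in> frontier Q" "off l x = 0" "inward x (fst l)"
    and z: "billiard_link Q x z" "off l z = 0" "z = x + s *\<^sub>R fst l" "s > 0"
  shows "- l \<in> Enter S \<longleftrightarrow> z \<in> S - vertices Q"
proof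
  assume "- l \<in> Enter S"
  then obtain y where y: "y \<in> S" "y \<notin> vertices Q" "off l y = 0" "inward y (- fst l)"
    using Enter_iff[OF S, of "- l"] by auto
  have "y \<in> frontier Q" using y S frontier_eq_sides by blast
  have "fst l \<noteq> 0" using l inward_nonzero by auto
  then obtain r where "y = x + r *\<^sub>R fst l" using off_zeroE[OF l(2) y(3)] by blast
  then have "y = x + (r / s) *\<^sub>R (z - x)" using z by simp
  then have "y = x \<or> y = z" using link_frontier[OF z(1) \<open>y \<in> frontier Q\<close>] by blast
  moreover have "y \<noteq> x"
    using inward_side[OF S y(1,2)] y(4) l(3) by auto
  ultimately show "z \<in> S - vertices Q" using y by blast
next
  assume z': "z \<in> S - vertices Q"
  have "inward z (x - z)" using z link_sym link_inward by blast
  moreover have "x - z = s *\<^sub>R (- fst l)" using z by simp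
  ultimately have "inward z (- fst l)" using inward_scale[OF z(4)] by metis
  then show "- l \<in> Enter S" using Enter_iff[OF S, of "- l"] z z' by auto
qed

text \<open>The whole line, not only the ray, meets the frontier in just two points. As
  \<open>off\<close> does not distinguish ahead from behind, this is what keeps the hyperplanes of
  two vertices apart within a beam.\<close>

lemma exit:
  assumes l: "x \<in> frontier Q" "off l x = 0" "inward x (fst l)"
  obtains z s where "billiard_link Q x z" "off l z = 0" "z = x + s *\<^sub>R fst l" "s > 0"
    "\<And>q. q \<in> frontier Q \<Longrightarrow> off l q = 0 \<Longrightarrow> q = x \<or> q = z"
    "\<And>S. S \<in> sides Q \<Longrightarrow> - l \<in> Enter S \<longleftrightarrow> z \<in> S - vertices Q"
proof -
  obtain z s where z: "s > 0" "z = x + s *\<^sub>R fst l" "billiard_link Q x z"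
    using exit_exists l by blast
  have "off l z = 0" using l(2) by (simp add: z off_def)
  moreover have "q = x \<or> q = z" if q: "q \<in> frontier Q" "off l q = 0" for q
  proof -
    obtain r where "q = x + r *\<^sub>R fst l"
      using off_zeroE[OF l(2) q(2)] inward_nonzero l by auto
    then have "q = x + (r / s) *\<^sub>R (z - x)" using z by simp
    then show ?thesis using link_frontier[OF z(3) q(1)] by blast
  qed
  ultimately show ?thesis using that[of z s] z exit_side l by blast
qed

subsection \<open>Beams of lines and their exits\<close>

text \<open>Both kinds of entry share what the count needs: at the vertices in \<open>Y\<close> the
  sign of \<open>off\<close> is constant on \<open>C\<close>, so only vertices outside
  \<open>Y\<close> can cut the beam.\<close>

definition beam :: "(plane \<times> real) set \<Rightarrow> plane set \<Rightarrow> bool" where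
  "beam C Y \<longleftrightarrow> (\<exists>S\<in>sides Q. C \<subseteq> Enter S \<and> Y = S) \<or> (\<exists>v\<in>vertices Q. C \<subseteq> EnterV v \<and> Y = {v})"

lemma beam_entry:
  assumes "beam C Y" "l \<in> C"
  obtains x where "x \<in> frontier Q" "x \<in> Y" "off l x = 0" "inward x (fst l)" "x \<notin> vertices Q \<or> Y = {x}"
  using assms(1) unfolding beam_def
proof (elim disjE bexE conjE)
  fix S assume "S \<in> sides Q" "C \<subseteq> Enter S" "Y = S"
  then show thesis using Enter_iff[of S l] assms(2) that frontier_eq_sides by blast
next
  fix v assume "v \<in> vertices Q" "C \<subseteq> EnterV v" "Y = {v}"
  then show thesis using assms(2) that[of v] vertices_subset_frontier by (auto simp: EnterV_def)
qed

lemma beam_sign: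
  assumes "beam C Y" "l \<in> C" "m \<in> C" "a \<in> Y" "a \<in> vertices Q"
  shows "off l a > 0 \<longleftrightarrow> off m a > 0" "off l a < 0 \<longleftrightarrow> off m a < 0" "off l a = 0 \<Longrightarrow> Y = {a}"
proof -
  have "(off l a > 0 \<longleftrightarrow> off m a > 0) \<and> (off l a < 0 \<longleftrightarrow> off m a < 0) \<and> (off l a = 0 \<longrightarrow> Y = {a})"
    using assms(1) unfolding beam_def
  proof (elim disjE bexE conjE)
    fix S assume S: "S \<in> sides Q" "C \<subseteq> Enter S" "Y = S"
    then have "a = lend S \<or> a = rend S" using assms(4,5) side_vertices by blast
    moreover have "l \<in> Enter S" "m \<in> Enter S" using S(2) assms(2,3) by auto
    ultimately show ?thesis by (auto simp: Enter_def)
  next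
    fix v assume "v \<in> vertices Q" "C \<subseteq> EnterV v" "Y = {v}"
    moreover have "l \<in> EnterV v" "m \<in> EnterV v" using \<open>C \<subseteq> EnterV v\<close> assms(2,3) by auto
    ultimately show ?thesis using assms(4) by (auto simp: EnterV_def)
  qed
  then show "off l a > 0 \<longleftrightarrow> off m a > 0" "off l a < 0 \<longleftrightarrow> off m a < 0" "off l a = 0 \<Longrightarrow> Y = {a}" by auto
qed

lemma beam_exit:
  assumes "beam C Y" "l \<in> C"
  obtains x z s where "x \<in> frontier Q" "x \<in> Y" "off l x = 0" "inward x (fst l)"
    "x \<notin> vertices Q \<or> Y = {x}" "billiard_link Q x z" "off l z = 0" "z = x + s *\<^sub>R fst l" "s > 0"
    "\<And>v. v \<in> vertices Q - Y \<Longrightarrow> off l v = 0 \<Longrightarrow> v = z"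
    "z \<in> vertices Q \<Longrightarrow> z \<in> vertices Q - Y"
    "\<And>S. S \<in> sides Q \<Longrightarrow> - l \<in> Enter S \<longleftrightarrow> z \<in> S - vertices Q"
proof -
  obtain x where x: "x \<in> frontier Q" "x \<in> Y" "off l x = 0" "inward x (fst l)"
      "x \<notin> vertices Q \<or> Y = {x}"
    by (rule beam_entry[OF assms]) (rule that)
  obtain z s where z: "billiard_link Q x z" "off l z = 0" "z = x + s *\<^sub>R fst l" "s > 0"
    "\<And>q. q \<in> frontier Q \<Longrightarrow> off l q = 0 \<Longrightarrow> q = x \<or> q = z"
    "\<And>S. S \<in> sides Q \<Longrightarrow> - l \<in> Enter S \<longleftrightarrow> z \<in> S - vertices Q"
    by (rule exit[OF x(1,3,4)]) (rule that)
  have "v = z" if "v \<in> vertices Q - Y" "off l v = 0" for v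
    using that z(5)[of v] x(2) vertices_subset_frontier by auto
  \<comment> \<open>A vertex of \<open>Y\<close> on the line forces \<open>Y = {z}\<close> and hence
    \<open>x = z\<close>, but the ends of a link are distinct.\<close>
  moreover have "z \<notin> Y" if "z \<in> vertices Q"
    using beam_sign(3)[OF assms assms(2) _ that] z(1,2) x(2) by (auto simp: billiard_link_def)
  ultimately show thesis using that[of x z s] x z by blast
qed

lemma
  assumes "beam C Y" "l \<in> C"
  shows beam_vertex_unique: "v \<in> vertices Q - Y \<Longrightarrow> v' \<in> vertices Q - Y \<Longrightarrow> off l v = 0 \<Longrightarrow> off l v' = 0 \<Longrightarrow> v = v'"
    and beam_side_unique: "S \<in> sides Q \<Longrightarrow> T \<in> sides Q \<Longrightarrow> - l \<in> Enter S \<Longrightarrow> - l \<in> Enter T \<Longrightarrow> S = T"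
    and beam_vertex_side: "S \<in> sides Q \<Longrightarrow> - l \<in> Enter S \<Longrightarrow> v \<in> vertices Q - Y \<Longrightarrow> off l v \<noteq> 0"
    and beam_leaves: "\<forall>v\<in>vertices Q - Y. off l v \<noteq> 0 \<Longrightarrow> \<exists>S\<in>sides Q. - l \<in> Enter S"
proof -
  obtain x z s where z: "x \<in> frontier Q" "x \<in> Y" "off l x = 0" "inward x (fst l)"
    "x \<notin> vertices Q \<or> Y = {x}" "billiard_link Q x z" "off l z = 0" "z = x + s *\<^sub>R fst l" "s > 0"
    "\<And>v. v \<in> vertices Q - Y \<Longrightarrow> off l v = 0 \<Longrightarrow> v = z"
    "z \<in> vertices Q \<Longrightarrow> z \<in> vertices Q - Y"
    "\<And>S. S \<in> sides Q \<Longrightarrow> - l \<in> Enter S \<longleftrightarrow> z \<in> S - vertices Q"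
    by (rule beam_exit[OF assms]) (rule that)
  show "v = v'" if "v \<in> vertices Q - Y" "v' \<in> vertices Q - Y" "off l v = 0" "off l v' = 0"
    using z(10)[of v] z(10)[of v'] that by simp
  show "S = T" if "S \<in> sides Q" "T \<in> sides Q" "- l \<in> Enter S" "- l \<in> Enter T"
    using z(12)[of S] z(12)[of T] that side_unique by blast
  show "off l v \<noteq> 0" if "S \<in> sides Q" "- l \<in> Enter S" "v \<in> vertices Q - Y"
    using z(12)[of S] z(10)[of v] that by blast
  show "\<exists>S\<in>sides Q. - l \<in> Enter S" if "\<forall>v\<in>vertices Q - Y. off l v \<noteq> 0"
  proof -
    have "z \<notin> vertices Q" using z(7,11) that by blast
    moreover obtain S where "S \<in> sides Q" "z \<in> S"
      using z(6) frontier_eq_sides by (auto simp: billiard_link_def)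
    ultimately show ?thesis using z(12) by blast
  qed
qed

lemma convex_Enter: "convex (Enter S)" and convex_uminus_Enter: "convex {l. - l \<in> Enter S}"
proof -
  have "linear (\<lambda>l. off l p)" for p by (rule off_linear)
  then have *: "convex {l. off l p < 0}" "convex {l. 0 < off l p}" for p
    using convex_linear_vimage[of "\<lambda>l. off l p" "{..<0}"] convex_linear_vimage[of "\<lambda>l. off l p" "{0<..}"]
    by (simp_all add: vimage_def)
  have "Enter S = {l. off l (rend S) < 0} \<inter> {l. 0 < off l (lend S)}"
    "{l. - l \<in> Enter S} = {l. 0 < off l (rend S)} \<inter> {l. off l (lend S) < 0}"
    by (auto simp: Enter_def)
  then show "convex (Enter S)" "convex {l. - l \<in> Enter S}"
    using * by (simp_all add: convex_Int)
qed

text \<open>Two lines of the beam leave through the same side iff they separate the vertices outside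
  \<open>Y\<close> in the same way, as no line of the beam passes through two of those vertices.\<close>

lemma card_exits:
  assumes beam: "beam C Y" and "convex C" "C \<noteq> {}"
    and pert: "\<And>v l. v \<in> vertices Q - Y \<Longrightarrow> l \<in> C \<Longrightarrow> off l v = 0 \<Longrightarrow>
           \<exists>m \<epsilon>. off m v \<noteq> 0 \<and> 0 < \<epsilon> \<and> (\<forall>t. \<bar>t\<bar> < \<epsilon> \<longrightarrow> l + t *\<^sub>R m \<in> C)"
  shows "card {S \<in> sides Q. \<exists>l\<in>C. - l \<in> Enter S} = Suc (card {v \<in> vertices Q - Y. \<exists>l\<in>C. off l v = 0})"
proof -
  define V where "V = vertices Q - Y"
  define G where "G = {l \<in> C. \<forall>v\<in>V. off l v \<noteq> 0}"
  define ex where "ex l = (THE S. S \<in> sides Q \<and> - l \<in> Enter S)" for l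
  define sg where "sg l = {v \<in> V. off l v > 0}" for l
  have "card (sg ` G) = Suc (card {v \<in> V. \<exists>l\<in>C. off l v = 0})"
    unfolding sg_def G_def
  proof (rule card_regions)
    fix v v' l assume *: "v \<in> V" "v' \<in> V" "v \<noteq> v'" "l \<in> C" "off l v = 0"
    then show "off l v' \<noteq> 0" using beam_vertex_unique[OF beam *(4)] unfolding V_def by blast
  qed (use assms finite_vertices in \<open>auto simp: V_def off_linear\<close>)
  moreover have ex_eq: "ex l = S" if "S \<in> sides Q" "l \<in> C" "- l \<in> Enter S" for l S
    unfolding ex_def
  proof (rule the_equality)
    fix T assume T: "T \<in> sides Q \<and> - l \<in> Enter T"
    then show "T = S" using beam_side_unique[OF beam that(2)] that by blast
  qed (use that in blast)
  moreover have ex_in: "ex l \<in> sides Q \<and> - l \<in> Enter (ex l)" if "l \<in> G" for l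
  proof -
    have "l \<in> C" "\<forall>v\<in>vertices Q - Y. off l v \<noteq> 0" using that by (auto simp: G_def V_def)
    then obtain S where "S \<in> sides Q" "- l \<in> Enter S" using beam_leaves[OF beam] by blast
    then show ?thesis using ex_eq[of S l] \<open>l \<in> C\<close> by simp
  qed
  have noV: "off l v \<noteq> 0" if "S \<in> sides Q" "l \<in> C" "- l \<in> Enter S" "v \<in> V" for S l v
    using beam_vertex_side[OF beam that(2)] that unfolding V_def by blast
  have "{S \<in> sides Q. \<exists>l\<in>C. - l \<in> Enter S} = ex ` G"
  proof (intro equalityI subsetI)
    fix S assume "S \<in> {S \<in> sides Q. \<exists>l\<in>C. - l \<in> Enter S}"
    then obtain l where l: "S \<in> sides Q" "l \<in> C" "- l \<in> Enter S" by auto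
    then have "l \<in> G" "ex l = S" using noV ex_eq by (auto simp: G_def)
    then show "S \<in> ex ` G" by auto
  next
    fix S assume "S \<in> ex ` G"
    then show "S \<in> {S \<in> sides Q. \<exists>l\<in>C. - l \<in> Enter S}" using ex_in by (auto simp: G_def)
  qed
  moreover have "card (ex ` G) = card (sg ` G)"
  proof (rule card_image_same_kernel)
    fix l m assume lm: "l \<in> G" "m \<in> G"
    then have lmC: "l \<in> C" "m \<in> C" by (auto simp: G_def)
    show "ex l = ex m \<longleftrightarrow> sg l = sg m"
    proof
      assume eq: "ex l = ex m"
      \<comment> \<open>The lines of \<open>C\<close> that leave through one side form a convex set
        on which no \<open>off\<close> at a vertex of \<open>V\<close> vanishes, so no sign can
        change on it.\<close>
      let ?D = "C \<inter> {k. - k \<in> Enter (ex m)}"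
      have conv: "convex ?D" using assms(2) convex_uminus_Enter by (intro convex_Int) auto
      have inD: "l \<in> ?D" "m \<in> ?D" using ex_in[OF lm(1)] ex_in[OF lm(2)] eq lmC by auto
      have "\<not> (off p v < 0 \<and> off q v > 0)" if "p \<in> ?D" "q \<in> ?D" "v \<in> V" for p q v
        using convex_sign_change[OF off_linear conv that(1,2)] noV[OF _ _ _ that(3)] ex_in[OF lm(2)] by blast
      then have "off l v > 0 \<longleftrightarrow> off m v > 0" if "v \<in> V" for v
        using inD that lm unfolding G_def by (metis (mono_tags, lifting) linorder_neqE_linordered_idom mem_Collect_eq)
      then show "sg l = sg m" by (auto simp: sg_def)
    next
      assume eq: "sg l = sg m"
      \<comment> \<open>Whether a line leaves through a side depends only on the signs at its two
        ends. These are recorded by \<open>sg\<close> outside \<open>Y\<close> and constant on the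
        beam inside \<open>Y\<close>.\<close>
      have sign: "(off l a > 0 \<longleftrightarrow> off m a > 0) \<and> (off l a < 0 \<longleftrightarrow> off m a < 0)" if "a \<in> vertices Q" for a
      proof (cases "a \<in> Y")
        case True
        then show ?thesis using beam_sign[OF beam lmC True that] by blast
      next
        case False
        have aV: "a \<in> V" using that False by (simp add: V_def)
        have "a \<in> sg l \<longleftrightarrow> a \<in> sg m" using eq by simp
        then have "off l a > 0 \<longleftrightarrow> off m a > 0" using aV by (simp add: sg_def)
        moreover have "off l a \<noteq> 0" "off m a \<noteq> 0" using aV lm unfolding G_def by blast+
        ultimately show ?thesis by linarith
      qed
      have S: "ex l \<in> sides Q" "- l \<in> Enter (ex l)" using ex_in lm by auto
      then have "- m \<in> Enter (ex l)"
        using sign[OF lend_vertex] sign[OF rend_vertex] by (auto simp: Enter_def)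
      then show "ex l = ex m" using ex_eq[OF S(1) lmC(2)] by simp
    qed
  qed
  ultimately show ?thesis by (simp add: V_def)
qed

section \<open>Reflected lines, unfolding and cells\<close>

text \<open>The image of a line under the reflection in \<open>S\<close>, oriented by the motion after the bounce. The
  reflection swaps left and right, whence the sign of \<open>off l\<close>.\<close>

definition bounce_off :: "plane set \<Rightarrow> plane \<times> real \<Rightarrow> plane \<times> real" where
  "bounce_off S l = (let d = mirror (rend S - lend S) (fst l) in (d, - off l (lend S) - cross2 d (lend S)))"

lemma side_pointE:
  assumes "S \<in> sides Q" "p \<in> S"
  obtains k where "p = lend S + k *\<^sub>R (rend S - lend S)"
proof -
  have "p \<in> closed_segment (lend S) (rend S)" using assms side_eq by blast
  then obtain k where "p = (1 - k) *\<^sub>R lend S + k *\<^sub>R rend S" unfolding in_segment by blast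
  then show ?thesis using that[of k] by (simp add: algebra_simps)
qed

lemma fst_bounce_off: "fst (bounce_off S l) = mirror (rend S - lend S) (fst l)"
  by (simp add: bounce_off_def Let_def)

lemma off_bounce_off:
  "off (bounce_off S l) p = cross2 (mirror (rend S - lend S) (fst l)) (p - lend S) - off l (lend S)"
  by (simp add: bounce_off_def Let_def off_def)

lemma off_bounce_off_side:
  assumes S: "S \<in> sides Q" and p: "p \<in> S"
  shows "off (bounce_off S l) p = - off l p"
proof -
  define e where "e = rend S - lend S"
  have e: "e \<noteq> 0" using ends_neq[OF S] by (simp add: e_def)
  obtain u where u: "p = lend S + u *\<^sub>R e" using side_pointE[OF S p] unfolding e_def .
  have "cross2 (mirror e (fst l)) e = - cross2 (fst l) e"
    using cross2_mirror[OF e, of "fst l" e] by simp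
  then show ?thesis by (simp add: off_bounce_off u flip: e_def) (simp add: off_def)
qed

lemma bounce_off_idem [simp]: "bounce_off S (bounce_off S l) = l"
  by (rule state_eqI[of _ _ "lend S"]) (simp_all add: fst_bounce_off off_bounce_off)

lemma bounce_off_linear: "linear (bounce_off S)"
  by (rule linearI; rule state_eqI[of _ _ "lend S"])
     (simp_all add: fst_bounce_off off_bounce_off linear_add[OF mirror_linear])

text \<open>An involution has its images as preimages, so that openness of the images follows from
  continuity.\<close>

lemma bounce_off_image: "bounce_off S ` A = bounce_off S -` A"
  by (auto intro: image_eqI[where x = "bounce_off S l" for l])

lemma bounce_off_Enter: "S \<in> sides Q \<Longrightarrow> bounce_off S l \<in> Enter S \<longleftrightarrow> - l \<in> Enter S"
  by (auto simp: Enter_def off_bounce_off_side lend_in rend_in)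

text \<open>The outgoing lines at the last bounce of the trajectories that start in \<open>K\<close> and then hit the
  sides in the list, which is read from right to left.\<close>

fun cell :: "(plane \<times> real) set \<Rightarrow> plane set list \<Rightarrow> (plane \<times> real) set" where
  "cell K [] = K"
| "cell K (S # w) = bounce_off S ` cell K w \<inter> Enter S"

fun entry :: "plane set \<Rightarrow> plane set list \<Rightarrow> plane set" where
  "entry X [] = X"
| "entry X (S # w) = S"

text \<open>The two kinds of initial beams: those of the sides lead to the complexity, those of the
  vertices to the generalized diagonals.\<close>

definition source :: "(plane \<times> real) set \<Rightarrow> plane set \<Rightarrow> bool" where
  "source K X \<longleftrightarrow> (\<exists>S\<in>sides Q. K = Enter S \<and> X = S) \<or> (\<exists>v\<in>vertices Q. K = EnterV v \<and> X = {v})"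

lemma source_Enter: "S \<in> sides Q \<Longrightarrow> source (Enter S) S"
  and source_EnterV: "v \<in> vertices Q \<Longrightarrow> source (EnterV v) {v}"
  by (auto simp: source_def)

lemma beam_cell: "source K X \<Longrightarrow> set w \<subseteq> sides Q \<Longrightarrow> beam (cell K w) (entry X w)"
  by (cases w) (auto simp: source_def beam_def)

lemma cell_Cons_nonempty:
  "S \<in> sides Q \<Longrightarrow> cell K (S # w) \<noteq> {} \<longleftrightarrow> (\<exists>l\<in>cell K w. - l \<in> Enter S)"
  unfolding cell.simps using bounce_off_Enter[of S] by blast

lemma convex_EnterV:
  assumes "v \<in> vertices Q"
  shows "convex (EnterV v)"
proof (rule convexI)
  fix l m r s assume *: "l \<in> EnterV v" "m \<in> EnterV v" "0 \<le> r" "0 \<le> s" "r + s = (1::real)"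
  have "v \<in> Q" using assms vertices_subset_frontier frontier_subset by blast
  then have "inward v (r *\<^sub>R fst l + s *\<^sub>R fst m)"
    using * by (intro inward_add) (auto simp: EnterV_def)
  then show "r *\<^sub>R l + s *\<^sub>R m \<in> EnterV v" using * by (simp add: EnterV_def)
qed

lemma convex_cell: "source K X \<Longrightarrow> convex (cell K w)"
  by (induction w) (auto simp: source_def convex_Enter convex_EnterV intro!: convex_Int
      convex_linear_image bounce_off_linear)

text \<open>Links of different lengths yield different positive multiples of the same line; cells do
  not distinguish them.\<close>

lemma cell_scale: "source K X \<Longrightarrow> l \<in> cell K w \<Longrightarrow> r > 0 \<Longrightarrow> r *\<^sub>R l \<in> cell K w"
proof (induction w arbitrary: l)
  case Nil
  then show ?case by (auto simp: source_def Enter_def EnterV_def inward_scale mult_pos_neg)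
next
  case (Cons S w)
  then obtain m where m: "m \<in> cell K w" "l = bounce_off S m" "l \<in> Enter S" by auto
  then have "r *\<^sub>R l = bounce_off S (r *\<^sub>R m)"
    by (simp add: linear_scale[OF bounce_off_linear])
  moreover have "r *\<^sub>R l \<in> Enter S" using m Cons.prems(3) by (auto simp: Enter_def mult_pos_neg)
  ultimately show ?case using Cons m by auto
qed

lemma open_Enter: "open (Enter S)"
  unfolding Enter_def by (intro open_Collect_conj open_Collect_less continuous_intros)

lemma open_bounce_off: "open A \<Longrightarrow> open (bounce_off S ` A)"
  unfolding bounce_off_image
  by (rule open_vimage) (auto simp: linear_continuous_on linear_conv_bounded_linear[symmetric] bounce_off_linear)

lemma open_cell: "open K \<Longrightarrow> open (cell K w)"
  by (induction w) (auto simp: open_Enter open_bounce_off)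

lemma open_inward: "open {l :: plane \<times> real. inward v (fst l)}"
proof -
  have "{l :: plane \<times> real. inward v (fst l)} = (\<Union>t\<in>{0<..}. (\<lambda>l. v + t *\<^sub>R fst l) -` interior Q)"
    by (auto simp: inward_def)
  also have "open \<dots>"
    by (intro open_UN ballI open_vimage continuous_intros) auto
  finally show ?thesis .
qed

text \<open>Here \<open>u\<close> is the image of the starting vertex \<open>v\<close> when the trajectory is unfolded into a line.
  It lies behind the moving point, so a vertex ahead is never focal to \<open>v\<close>.\<close>

lemma cell_EnterV:
  assumes "v \<in> vertices Q" "set w \<subseteq> sides Q"
  shows "\<exists>u A. open A \<and> cell (EnterV v) w = {m. off m u = 0} \<inter> A \<and>
    (\<forall>l\<in>cell (EnterV v) w. \<forall>q\<in>Q - entry {v} w. off l q = 0 \<longrightarrow> 0 < fst l \<bullet> (q - u))"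
  using assms(2)
proof (induction w)
  case Nil
  \<comment> \<open>Before any bounce the image of \<open>v\<close> is \<open>v\<close>. A point of
    \<open>Q\<close> behind it on the line would put \<open>v\<close> between this point and an
    interior point, hence into the interior.\<close>
  have "0 < d \<bullet> (q - v)" if d: "inward v d" "q \<in> Q" "q \<noteq> v" "c + cross2 d v = 0" "c + cross2 d q = 0" for c d q
  proof -
    have v: "v \<in> frontier Q" using assms(1) vertices_subset_frontier by blast
    then have "d \<noteq> 0" using inward_nonzero d(1) by blast
    moreover have "cross2 d (q - v) = 0" using d(4,5) by simp
    ultimately obtain s where s: "q - v = s *\<^sub>R d" using cross2_eq_0E by blast
    have "s \<noteq> 0" using s d(3) by auto
    moreover have "\<not> s < 0"
    proof
      assume "s < 0"
      obtain t where t: "t > 0" "v + t *\<^sub>R d \<in> interior Q" using d(1) by (auto simp: inward_def)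
      define p where "p = v + t *\<^sub>R d"
      have q: "q = v + s *\<^sub>R d" using s by (simp add: algebra_simps)
      define r where "r = t / (t - s)"
      have r: "0 < r" "r < 1" "r * (t - s) = t" using t \<open>s < 0\<close> by (auto simp: r_def)
      have "(1 - r) *\<^sub>R p + r *\<^sub>R q = v + (t - r * (t - s)) *\<^sub>R d"
        by (simp add: p_def q algebra_simps)
      then have "v = (1 - r) *\<^sub>R p + r *\<^sub>R q" using r by simp
      moreover have "p \<noteq> q"
        using v frontier_not_interior t \<open>s < 0\<close> s \<open>d \<noteq> 0\<close> by (auto simp: p_def algebra_simps)
      ultimately have "v \<in> open_segment p q"
        using r unfolding in_segment by blast
      then show False
        using segment_interior[of p q] t d(2) v frontier_not_interior by (auto simp: p_def)
    qed
    ultimately show ?thesis using s \<open>d \<noteq> 0\<close> by simp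
  qed
  then show ?case
    by (intro exI[of _ v] exI[of _ "{l. inward v (fst l)}"])
       (auto simp: open_inward EnterV_def off_def add.commute)
next
  case (Cons S w)
  have S: "S \<in> sides Q" and w: "set w \<subseteq> sides Q" using Cons.prems by auto
  define K where "K = EnterV v"
  obtain u A where u: "open A" "cell K w = {m. off m u = 0} \<inter> A"
    "\<And>l q. l \<in> cell K w \<Longrightarrow> q \<in> Q - entry {v} w \<Longrightarrow> off l q = 0 \<Longrightarrow> 0 < fst l \<bullet> (q - u)"
    using Cons.IH[OF w] unfolding K_def by blast
  define e where "e = rend S - lend S"
  have e: "e \<noteq> 0" using ends_neq[OF S] by (simp add: e_def)
  \<comment> \<open>One more bounce is unfolded by reflecting the old image in \<open>S\<close>: a
    line passes through \<open>u\<close> iff its reflection passes through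
    \<open>u'\<close>.\<close>
  define u' where "u' = lend S + mirror e (u - lend S)"
  have off_u': "off (bounce_off S l) u' = - off l u" for l
    using cross2_mirror[OF e, of "fst l" "u - lend S"]
    by (simp add: off_bounce_off u'_def flip: e_def) (simp add: off_def)
  have "cell K (S # w) = {m. off m u' = 0} \<inter> (bounce_off S ` A \<inter> Enter S)"
    using off_u' by (auto simp: u(2))
  moreover have "open (bounce_off S ` A \<inter> Enter S)"
    using u(1) open_bounce_off open_Enter by blast
  moreover have "0 < fst l \<bullet> (q - u')" if l: "l \<in> cell K (S # w)" and q: "q \<in> Q" "q \<notin> S" "off l q = 0" for l q
  proof -
    obtain m where m: "m \<in> cell K w" "l = bounce_off S m" "l \<in> Enter S" using l by auto
    have "- m \<in> Enter S" using m bounce_off_Enter[OF S] by auto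
    then obtain y where y: "y \<in> S" "y \<notin> vertices Q" "off m y = 0" using Enter_iff[OF S, of "- m"] by auto
    have ly: "off l y = 0" using y off_bounce_off_side[OF S] m by simp
    \<comment> \<open>With this the induction hypothesis applies to the bounce point:
      \<open>y\<close> lies ahead of \<open>u\<close> on the incoming line, so ahead of
      \<open>u'\<close> on the outgoing one, and \<open>q\<close> lies ahead of
      \<open>y\<close>.\<close>
    have "y \<notin> entry {v} w"
    proof (cases w)
      case Nil
      then show ?thesis using y assms by auto
    next
      case (Cons T w')
      have "T \<noteq> S" using m(1) \<open>- m \<in> Enter S\<close> Cons by (auto simp: Enter_def)
      then show ?thesis using side_unique[OF S _ y(1) _ y(2)] w Cons by auto
    qed
    then have "0 < fst m \<bullet> (y - u)" using u(3)[OF m(1), of y] y side_subset[OF S] by auto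
    also have "fst m \<bullet> (y - u) = fst l \<bullet> (mirror e (y - u))"
      using inner_mirror[of e "fst m" "y - u"] by (simp add: m(2) fst_bounce_off flip: e_def)
    also have "mirror e (y - u) = y - u'"
    proof -
      obtain k where "y = lend S + k *\<^sub>R e" using side_pointE[OF S y(1)] unfolding e_def .
      then have "y - lend S = k *\<^sub>R e" by simp
      then have "mirror e (y - lend S) = y - lend S" by (simp del: mirror_diff)
      then show ?thesis by (simp add: u'_def algebra_simps)
    qed
    finally have 1: "0 < fst l \<bullet> (y - u')" .
    have yin: "inward y (fst l)"
      using inward_side[OF S y(1,2)] m(3) off_side_diff[of l S] by (auto simp: Enter_def)
    have yfr: "y \<in> frontier Q" using y(1) S frontier_eq_sides by blast
    then obtain s where s: "q = y + s *\<^sub>R fst l"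
      using off_zeroE[OF ly q(3)] inward_nonzero yin by blast
    have "0 < cross2 e (q - lend S)" using side_pos[OF S q(1,2)] by (simp add: e_def)
    moreover have "cross2 e (y - lend S) = 0"
    proof -
      obtain k where "y = lend S + k *\<^sub>R e" using side_pointE[OF S y(1)] unfolding e_def .
      then have "y - lend S = k *\<^sub>R e" by simp
      then show ?thesis by (simp del: cross2_simps(4))
    qed
    ultimately have "0 < s * cross2 e (fst l)" by (simp add: s)
    moreover have "0 < cross2 e (fst l)" using inward_side[OF S y(1,2)] yin by (simp add: e_def)
    ultimately have "0 < s" by (simp add: zero_less_mult_iff)
    then have "0 \<le> fst l \<bullet> (q - y)" by (simp add: s)
    then show ?thesis using 1 by (simp add: inner_diff_right)
  qed
  ultimately show ?case unfolding K_def by (intro exI[of _ u'] exI) auto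
qed

text \<open>A line leaves through \<open>S\<close> iff its reflection lies in the cell of the longer
  word, so exits of the beam are extensions of \<open>w\<close>. What remains is to find, at each
  line through a vertex ahead, a direction off that vertex that stays in the cell.\<close>

lemma card_cell_Cons:
  assumes K: "source K X" and w: "set w \<subseteq> sides Q" and ne: "cell K w \<noteq> {}"
  shows "card {S \<in> sides Q. cell K (S # w) \<noteq> {}}
    = Suc (card {v \<in> vertices Q - entry X w. \<exists>l\<in>cell K w. off l v = 0})"
proof -
  have "{S \<in> sides Q. cell K (S # w) \<noteq> {}} = {S \<in> sides Q. \<exists>l\<in>cell K w. - l \<in> Enter S}"
    using cell_Cons_nonempty by blast
  moreover have "card {S \<in> sides Q. \<exists>l\<in>cell K w. - l \<in> Enter S}
      = Suc (card {v \<in> vertices Q - entry X w. \<exists>l\<in>cell K w. off l v = 0})"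
  proof (rule card_exits[OF beam_cell[OF K w] convex_cell[OF K] ne])
    fix v l assume v: "v \<in> vertices Q - entry X w" and l: "l \<in> cell K w" "off l v = 0"
    show "\<exists>m \<epsilon>. off m v \<noteq> 0 \<and> 0 < \<epsilon> \<and> (\<forall>t. \<bar>t\<bar> < \<epsilon> \<longrightarrow> l + t *\<^sub>R m \<in> cell K w)"
      using K unfolding source_def
    proof (elim disjE bexE conjE)
      fix S assume "K = Enter S"
      then have "open (cell K w)" using open_cell open_Enter by blast
      \<comment> \<open>The cell is open, so parallel translation works.\<close>
      then obtain \<epsilon> where "\<epsilon> > 0" "\<forall>t. \<bar>t\<bar> < \<epsilon> \<longrightarrow> l + t *\<^sub>R (0, 1) \<in> cell K w"
        using open_perturb l by blast
      then show ?thesis by (intro exI[of _ "(0, 1)"] exI[of _ \<epsilon>]) (auto simp: off_def)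
    next
      fix v0 assume v0: "v0 \<in> vertices Q" "K = EnterV v0" "X = {v0}"
      then obtain u A where u: "open A" "cell K w = {m. off m u = 0} \<inter> A"
        "\<forall>l\<in>cell K w. \<forall>q\<in>Q - entry X w. off l q = 0 \<longrightarrow> 0 < fst l \<bullet> (q - u)"
        using cell_EnterV[OF v0(1) w] by auto
      have "v \<in> Q" using v vertices_subset_frontier frontier_subset by blast
      then have "v \<noteq> u" using u(3) l v by force
      \<comment> \<open>Adding multiples of a line through \<open>u\<close> turns \<open>l\<close>
        about \<open>u\<close> and so stays in the hyperplane of the cell. The direction orthogonal
        to \<open>v - u\<close> makes the offset at \<open>v\<close> minus the squared distance from
        \<open>u\<close>.\<close>
      define m where "m = line u (normal (v - u))"
      obtain \<epsilon> where \<epsilon>: "\<epsilon> > 0" "\<forall>t. \<bar>t\<bar> < \<epsilon> \<longrightarrow> l + t *\<^sub>R m \<in> A"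
        using open_perturb[OF u(1)] l u(2) by blast
      have "cross2 (normal (v - u)) (v - u) = - ((v - u) \<bullet> (v - u))"
        by (subst cross2_swap) (simp only: cross2_normal)
      then have "off m v \<noteq> 0" using \<open>v \<noteq> u\<close> by (simp add: m_def off_line del: cross2_simps(4))
      moreover have "off m u = 0" by (simp add: m_def off_line)
      then have "l + t *\<^sub>R m \<in> cell K w" if "\<bar>t\<bar> < \<epsilon>" for t
        using \<epsilon> l that by (auto simp: u(2))
      ultimately show ?thesis using \<epsilon>(1) by blast
    qed
  qed
  ultimately show ?thesis by simp
qed

section \<open>Counting words and their extensions\<close>

definition words :: "(plane \<times> real) set \<Rightarrow> nat \<Rightarrow> plane set list set" where
  "words K n = {w. length w = n \<and> set w \<subseteq> sides Q \<and> cell K w \<noteq> {}}"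

definition hits :: "(plane \<times> real) set \<Rightarrow> plane set \<Rightarrow> nat \<Rightarrow> (plane set list \<times> plane) set" where
  "hits K X n = {(w, v). w \<in> words K n \<and> v \<in> vertices Q - entry X w \<and> (\<exists>l\<in>cell K w. off l v = 0)}"

lemma finite_words: "finite (words K n)"
  by (rule finite_subset[OF _ finite_lists_length_eq[OF finite_sides, of n]]) (auto simp: words_def)

lemma finite_hits: "finite (hits K X n)"
  by (rule finite_subset[of _ "words K n \<times> vertices Q"])
     (auto simp: hits_def finite_words finite_vertices)

lemma card_words_Suc:
  assumes "source K X"
  shows "card (words K (Suc n)) = card (words K n) + card (hits K X n)"
proof -
  let ?ext = "\<lambda>w. {S \<in> sides Q. cell K (S # w) \<noteq> {}}"
  let ?hit = "\<lambda>w. {v \<in> vertices Q - entry X w. \<exists>l\<in>cell K w. off l v = 0}"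
  have "words K (Suc n) = (\<lambda>(w, S). S # w) ` (SIGMA w:words K n. ?ext w)"
    by (force simp: words_def length_Suc_conv image_iff)
  moreover have "inj_on (\<lambda>(w, S). S # w) (SIGMA w:words K n. ?ext w)" by (auto simp: inj_on_def)
  ultimately have "card (words K (Suc n)) = (\<Sum>w\<in>words K n. card (?ext w))"
    using finite_words finite_sides by (simp add: card_image)
  also have "\<dots> = (\<Sum>w\<in>words K n. 1 + card (?hit w))"
    by (rule sum.cong) (use card_cell_Cons[OF assms] in \<open>auto simp: words_def\<close>)
  also have "\<dots> = card (words K n) + card (SIGMA w:words K n. ?hit w)"
    using finite_words finite_vertices by (simp add: sum_Suc)
  also have "(SIGMA w:words K n. ?hit w) = hits K X n" by (auto simp: hits_def)
  finally show ?thesis .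
qed

lemma line_Enter:
  assumes "S \<in> sides Q" "x \<in> S" "x \<notin> vertices Q" "q \<in> Q" "q \<notin> S"
  shows "line x (q - x) \<in> Enter S"
proof -
  define e where "e = rend S - lend S"
  obtain k where "x = lend S + k *\<^sub>R e" using side_pointE[OF assms(1,2)] unfolding e_def .
  then have "cross2 e (q - x) = cross2 e (q - lend S)" by simp
  then have "inward x (q - x)"
    using inward_side[OF assms(1-3)] side_pos[OF assms(1,4,5)] by (simp add: e_def)
  moreover have "off (line x (q - x)) x = 0" by (simp add: off_line)
  ultimately show ?thesis using Enter_iff[OF assms(1), of "line x (q - x)"] assms(2,3) by auto
qed

lemma side_has_point: "S \<in> sides Q \<Longrightarrow> \<exists>x. x \<in> S \<and> x \<notin> vertices Q"
  using open_side[of S] ends_neq[of S] by (metis Diff_iff midpoint_in_open_segment)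

lemma sides_nonempty: "sides Q \<noteq> {}"
proof
  assume "sides Q = {}"
  then have "frontier Q = {}" using frontier_eq_sides by simp
  then show False using frontier_eq_empty[of Q] interior_nonempty compact compact_imp_bounded not_bounded_UNIV
    by (metis interior_empty)
qed

text \<open>No cyclic order of the boundary is involved: the lines entering through a side
  \<open>S\<close> leave through every other side and can run into every vertex except the two ends
  of \<open>S\<close>. Counting exits gives |sides| - 1 = 1 + (|vertices| - 2).\<close>

lemma card_sides_eq_card_vertices: "card (sides Q) = card (vertices Q)"
proof -
  obtain S where S: "S \<in> sides Q" using sides_nonempty by blast
  obtain x where x: "x \<in> S" "x \<notin> vertices Q" using side_has_point[OF S] by blast
  have sub: "vertices Q \<subseteq> Q" using vertices_subset_frontier frontier_subset by blast
  have other: "\<exists>q\<in>T - vertices Q. q \<notin> S" if "T \<in> sides Q" "T \<noteq> S" for T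
    using side_has_point[OF that(1)] side_unique[OF that(1) S] that by blast
  have ex: "\<exists>l\<in>Enter S. - l \<in> Enter T" if T: "T \<in> sides Q" "T \<noteq> S" for T
  proof -
    obtain q where q: "q \<in> T" "q \<notin> vertices Q" "q \<notin> S" using other[OF T] by blast
    have "x \<notin> T" using side_unique[OF S T(1)] x T(2) by blast
    have "line x (q - x) \<in> Enter S"
      using line_Enter[OF S x] q side_subset[OF T(1)] by blast
    moreover have "line q (x - q) \<in> Enter T"
      using line_Enter[OF T(1) q(1,2)] x(1) \<open>x \<notin> T\<close> side_subset[OF S] by blast
    moreover have "line q (x - q) = - line x (q - x)"
      by (rule state_eqI[of _ _ x]) (simp_all add: off_line)
    ultimately show ?thesis by auto
  qed
  \<comment> \<open>Were \<open>S\<close> the only side, a link from \<open>x\<close> through the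
    interior would end on \<open>S\<close> again and thus run inside the convex set
    \<open>S\<close>.\<close>
  have "\<exists>T. T \<in> sides Q \<and> T \<noteq> S"
  proof (rule ccontr)
    assume "\<not> ?thesis"
    then have "sides Q = {S}" using S by blast
    then have "frontier Q = S" unfolding frontier_eq_sides by simp
    moreover obtain p where p: "p \<in> interior Q" using interior_nonempty by blast
    obtain z s where "billiard_link Q x z" "z = x + s *\<^sub>R (p - x)" "s > 0"
    proof (rule exit_exists[of x "p - x"])
      show "x \<in> frontier Q" using x S frontier_eq_sides by blast
      show "inward x (p - x)" using p unfolding inward_def by (intro exI[of _ 1]) auto
    qed
    ultimately have z: "z \<in> S" "x \<in> S" "billiard_link Q x z" using x by (auto simp: billiard_link_def)
    then have "x \<noteq> z" "open_segment x z \<subseteq> interior Q" by (auto simp: billiard_link_def)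
    then have "midpoint x z \<in> interior Q" using midpoint_in_open_segment[of x z] by blast
    moreover have "midpoint x z \<in> S"
      using closed_segment_subset[OF z(2,1) face_of_imp_convex[OF side_face[OF S]]]
        midpoint_in_closed_segment[of x z] by blast
    ultimately show False using S frontier_eq_sides frontier_not_interior by blast
  qed
  then have "Enter S \<noteq> {}" using ex by blast
  have "card {T \<in> sides Q. cell (Enter S) [T] \<noteq> {}}
      = Suc (card {v \<in> vertices Q - S. \<exists>l\<in>Enter S. off l v = 0})"
    using card_cell_Cons[OF source_Enter[OF S], of "[]"] \<open>Enter S \<noteq> {}\<close> by simp
  moreover have "{T \<in> sides Q. cell (Enter S) [T] \<noteq> {}} = sides Q - {S}"
  proof -
    have "\<not> (l \<in> Enter S \<and> - l \<in> Enter S)" for l by (auto simp: Enter_def)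
    then have "cell (Enter S) [T] \<noteq> {} \<longleftrightarrow> T \<noteq> S" if "T \<in> sides Q" for T
      using cell_Cons_nonempty[OF that, of "Enter S" "[]"] ex[OF that] unfolding cell.simps(1) by blast
    then show ?thesis by blast
  qed
  moreover have "{v \<in> vertices Q - S. \<exists>l\<in>Enter S. off l v = 0} = vertices Q - {lend S, rend S}"
  proof -
    have "\<exists>l\<in>Enter S. off l v = 0" if "v \<in> vertices Q" "v \<notin> S" for v
      using line_Enter[OF S x, of v] sub that by (intro bexI[of _ "line x (v - x)"]) (auto simp: off_line)
    then show ?thesis using side_vertices[OF S] by blast
  qed
  moreover have "card (vertices Q - {lend S, rend S}) = card (vertices Q) - 2"
    using ends_neq[OF S] lend_vertex[OF S] rend_vertex[OF S] by (subst card_Diff_subset) auto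
  moreover have "card {lend S, rend S} \<le> card (vertices Q)"
    using lend_vertex[OF S] rend_vertex[OF S] finite_vertices by (intro card_mono) auto
  ultimately show ?thesis using S finite_sides ends_neq[OF S] by (simp add: card_Diff_singleton)
qed

subsection \<open>Billiard trajectories\<close>

definition billiard_path :: "plane list \<Rightarrow> bool" where
  "billiard_path xs \<longleftrightarrow>
     (\<forall>i. Suc i < length xs \<longrightarrow> billiard_link Q (xs ! i) (xs ! Suc i)) \<and>
     (\<forall>i. Suc (Suc i) < length xs \<longrightarrow> bounce Q (xs ! i) (xs ! Suc i) (xs ! Suc (Suc i)))"

lemma billiard_path_Cons:
  "billiard_path (x # y # z # r) \<longleftrightarrow> billiard_link Q x y \<and> bounce Q x y z \<and> billiard_path (y # z # r)"
  unfolding billiard_path_def by (auto simp: All_less_Suc2)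

lemma billiard_path_two [simp]: "billiard_path [x, y] \<longleftrightarrow> billiard_link Q x y"
  by (auto simp: billiard_path_def less_Suc_eq)

text \<open>The side in \<open>bounce\<close> is forced at a non-vertex, and its normal is forced up
  to scale. The law of reflection thus becomes an equation for the fixed map
  \<open>mirror\<close>.\<close>

lemma bounce_iff:
  assumes S: "S \<in> sides Q" and y: "y \<in> S" "y \<notin> vertices Q"
  shows "bounce Q x y z \<longleftrightarrow> sgn (z - y) = mirror (rend S - lend S) (sgn (y - x))"
proof
  assume "bounce Q x y z"
  then obtain T n where T: "T \<in> sides Q" "n \<noteq> 0" "y \<in> T" "\<forall>p\<in>T. orthogonal n (p - y)"
    "sgn (z - y) = reflect n (sgn (y - x))"
    by (auto simp: bounce_def)
  have "T = S" using side_unique[OF T(1) S T(3) y] .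
  then have "orthogonal n (rend S - y)" "orthogonal n (lend S - y)" using T(4) lend_in[OF S] rend_in[OF S] by auto
  then have "orthogonal n (rend S - lend S)" by (simp add: orthogonal_def inner_diff_right)
  then have "reflect n = mirror (rend S - lend S)"
    using ends_neq[OF S] T(2) by (intro reflect_eq_mirror) auto
  then show "sgn (z - y) = mirror (rend S - lend S) (sgn (y - x))" using T by simp
next
  assume *: "sgn (z - y) = mirror (rend S - lend S) (sgn (y - x))"
  have "orthogonal (normal (rend S - lend S)) (p - y)" if p: "p \<in> S" for p
  proof -
    define e where "e = rend S - lend S"
    obtain j where "p = lend S + j *\<^sub>R e" using side_pointE[OF S p] unfolding e_def .
    moreover obtain k where "y = lend S + k *\<^sub>R e" using side_pointE[OF S y(1)] unfolding e_def .
    ultimately show ?thesis by (simp add: orthogonal_def inner_normal flip: e_def)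
  qed
  then show "bounce Q x y z"
    using * S y ends_neq[OF S] unfolding bounce_def mirror_def
    by (intro conjI bexI[of _ S] exI[of _ "normal (rend S - lend S)"]) auto
qed

lemma bounce_sym: "bounce Q x y z \<longleftrightarrow> bounce Q z y x"
proof -
  have "bounce Q z y x" if b: "bounce Q x y z" for x z
  proof -
    obtain S where S: "S \<in> sides Q" "y \<in> S" "y \<notin> vertices Q" using b by (auto simp: bounce_def)
    define e where "e = rend S - lend S"
    have "sgn (z - y) = mirror e (sgn (y - x))" using b bounce_iff[OF S] by (simp add: e_def)
    then have "mirror e (sgn (z - y)) = sgn (y - x)" by simp
    then have "mirror e (- sgn (z - y)) = - sgn (y - x)" by simp
    then show ?thesis using bounce_iff[OF S] by (simp add: e_def flip: sgn_minus)
  qed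
  then show ?thesis by blast
qed

lemma billiard_path_rev: "billiard_path (rev xs) \<longleftrightarrow> billiard_path xs"
proof -
  have "billiard_path (rev xs)" if p: "billiard_path xs" for xs
    unfolding billiard_path_def
  proof (intro conjI allI impI)
    fix i assume i: "Suc i < length (rev xs)"
    define j where "j = length xs - Suc (Suc i)"
    have "rev xs ! i = xs ! Suc j" "rev xs ! Suc i = xs ! j" "Suc j < length xs"
      using i by (auto simp: rev_nth j_def Suc_diff_Suc)
    then show "billiard_link Q (rev xs ! i) (rev xs ! Suc i)"
      using p link_sym by (auto simp: billiard_path_def)
  next
    fix i assume i: "Suc (Suc i) < length (rev xs)"
    define j where "j = length xs - Suc (Suc (Suc i))"
    have "rev xs ! i = xs ! Suc (Suc j)" "rev xs ! Suc i = xs ! Suc j" "rev xs ! Suc (Suc i) = xs ! j"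
      "Suc (Suc j) < length xs"
      using i by (auto simp: rev_nth j_def Suc_diff_Suc)
    then show "bounce Q (rev xs ! i) (rev xs ! Suc i) (rev xs ! Suc (Suc i))"
      using p bounce_sym by (auto simp: billiard_path_def)
  qed
  from this[of xs] this[of "rev xs"] show ?thesis by auto
qed

lemma link_not_same_side:
  assumes "billiard_link Q y z" "S \<in> sides Q" "y \<in> S"
  shows "z \<notin> S"
proof
  assume "z \<in> S"
  then have "closed_segment y z \<subseteq> S"
    using closed_segment_subset face_of_imp_convex[OF side_face] assms by blast
  moreover have "y \<noteq> z" "open_segment y z \<subseteq> interior Q" using assms(1) by (auto simp: billiard_link_def)
  ultimately have "midpoint y z \<in> S" "midpoint y z \<in> interior Q"
    using midpoint_in_open_segment[of y z] midpoint_in_closed_segment[of y z] by blast+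
  then show False using assms(2) frontier_eq_sides frontier_not_interior by blast
qed

section \<open>Trajectories with a given code\<close>

abbreviation coded :: "plane list \<Rightarrow> plane set list \<Rightarrow> bool" where
  "coded \<equiv> list_all2 (\<lambda>y S. y \<in> S - vertices Q)"

definition start :: "plane set \<Rightarrow> plane \<Rightarrow> bool" where
  "start X x \<longleftrightarrow> x \<in> X \<and> (x \<notin> vertices Q \<or> X = {x})"

lemma start_side:
  assumes S: "S \<in> sides Q"
  shows "start S x \<longleftrightarrow> x \<in> S - vertices Q"
proof -
  have "S \<noteq> {x}" using lend_in[OF S] rend_in[OF S] ends_neq[OF S] by auto
  then show ?thesis by (auto simp: start_def)
qed

lemma start_singleton [simp]: "start {v} x \<longleftrightarrow> x = v"
  by (auto simp: start_def)

lemma start_line: "source K X \<Longrightarrow> start X x \<Longrightarrow> billiard_link Q x z \<Longrightarrow> line x (z - x) \<in> K"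
  unfolding source_def
proof (elim disjE bexE conjE)
  fix S assume "S \<in> sides Q" "K = Enter S" "X = S" "start X x" "billiard_link Q x z"
  then show ?thesis
    using Enter_iff[of S "line x (z - x)"] start_side[of S x] link_inward
    by (auto simp: off_line intro!: bexI[of _ x])
next
  fix v assume "K = EnterV v" "X = {v}" "start X x" "billiard_link Q x z"
  then show ?thesis using link_inward by (simp add: EnterV_def off_line)
qed

text \<open>The lists run backwards in time: \<open>x0\<close> is the start, the head of
  \<open>ys @ [x0]\<close> the latest boundary point before \<open>z\<close>, and \<open>z\<close>
  the next one. A further bounce is then a cons on both lists.\<close>

lemma path_cell:
  assumes K: "source K X" "start X x0"
  shows "set w \<subseteq> sides Q \<Longrightarrow> coded ys w \<Longrightarrow> billiard_path (z # ys @ [x0]) \<Longrightarrow>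
    line (hd (ys @ [x0])) (z - hd (ys @ [x0])) \<in> cell K w"
proof (induction ys arbitrary: z w)
  case Nil
  then show ?case using start_line[OF K] link_sym by auto
next
  case (Cons y ys)
  then obtain S w' where w: "w = S # w'" "S \<in> sides Q" "y \<in> S" "y \<notin> vertices Q" "set w' \<subseteq> sides Q" "coded ys w'"
    by (auto simp: list_all2_Cons1)
  define y' where "y' = hd (ys @ [x0])"
  obtain r where r: "ys @ [x0] = y' # r" unfolding y'_def by (cases ys) auto
  have p: "billiard_link Q z y" "bounce Q z y y'" "billiard_path (y # ys @ [x0])"
    using Cons.prems(3) r by (auto simp: billiard_path_Cons)
  define m where "m = line y' (y - y')"
  have m: "m \<in> cell K w'" using Cons.IH[OF w(5,6) p(3)] by (simp add: m_def y'_def)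
  have "billiard_link Q y y'" using p(3) r by (cases r) (auto simp: billiard_path_Cons)
  then have ne: "y \<noteq> y'" "y \<noteq> z" using p(1) by (auto simp: billiard_link_def)
  define e where "e = rend S - lend S"
  \<comment> \<open>Rescales the direction of the incoming link to the length of the outgoing
    one.\<close>
  define k where "k = norm (z - y) / norm (y - y')"
  have k: "k > 0" using ne by (simp add: k_def)
  have "bounce Q y' y z" using p(2) bounce_sym by blast
  then have sg: "sgn (z - y) = mirror e (sgn (y - y'))" using bounce_iff[OF w(2-4)] by (simp add: e_def)
  have "z - y = norm (z - y) *\<^sub>R sgn (z - y)" using ne by (simp add: sgn_div_norm)
  also have "\<dots> = mirror e (norm (z - y) *\<^sub>R sgn (y - y'))" unfolding sg by simp
  also have "norm (z - y) *\<^sub>R sgn (y - y') = k *\<^sub>R (y - y')"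
    by (simp add: sgn_div_norm k_def divide_inverse)
  finally have zy: "z - y = mirror e (k *\<^sub>R (y - y'))" .
  have "line y (z - y) = bounce_off S (k *\<^sub>R m)"
  proof (rule state_eqI[of _ _ y])
    show "fst (line y (z - y)) = fst (bounce_off S (k *\<^sub>R m))"
      using zy by (simp add: fst_bounce_off m_def e_def)
    show "off (line y (z - y)) y = off (bounce_off S (k *\<^sub>R m)) y"
      using off_bounce_off_side[OF w(2,3), of "k *\<^sub>R m"] by (simp add: off_line m_def)
  qed
  moreover have "k *\<^sub>R m \<in> cell K w'" using cell_scale[OF K(1) m k] .
  moreover have "line y (z - y) \<in> Enter S"
    using start_line[OF source_Enter[OF w(2)]] start_side[OF w(2)] w(3,4) p(1) link_sym by blast
  ultimately show ?case using w by auto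
qed

text \<open>The next point \<open>z\<close> is left open because it will be a vertex, a point of a
  further side, or a point of an infinite orbit.\<close>

lemma cell_path:
  assumes K: "source K X"
  shows "set w \<subseteq> sides Q \<Longrightarrow> l \<in> cell K w \<Longrightarrow>
    \<exists>ys x0. start X x0 \<and> coded ys w \<and> hd (ys @ [x0]) \<in> frontier Q \<and> start (entry X w) (hd (ys @ [x0])) \<and>
      off l (hd (ys @ [x0])) = 0 \<and> inward (hd (ys @ [x0])) (fst l) \<and>
      (\<forall>z s. s > 0 \<longrightarrow> billiard_link Q (hd (ys @ [x0])) z \<longrightarrow> z = hd (ys @ [x0]) + s *\<^sub>R fst l \<longrightarrow>
         billiard_path (z # ys @ [x0]))"
proof (induction w arbitrary: l)
  case Nil
  have "beam K X" using beam_cell[OF K, of "[]"] by simp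
  then obtain x where x: "x \<in> frontier Q" "x \<in> X" "off l x = 0" "inward x (fst l)" "x \<notin> vertices Q \<or> X = {x}"
    using Nil(2) by (auto elim: beam_entry)
  then show ?case using link_sym by (intro exI[of _ "[]"] exI[of _ x]) (auto simp: start_def)
next
  case (Cons S w)
  have S: "S \<in> sides Q" and w: "set w \<subseteq> sides Q" using Cons.prems by auto
  obtain m where m: "m \<in> cell K w" "l = bounce_off S m" "l \<in> Enter S" using Cons.prems by auto
  obtain ys x0 where x0: "start X x0" "coded ys w" "hd (ys @ [x0]) \<in> frontier Q"
      "off m (hd (ys @ [x0])) = 0" "inward (hd (ys @ [x0])) (fst m)"
    and ext: "\<And>z s. s > 0 \<Longrightarrow> billiard_link Q (hd (ys @ [x0])) z \<Longrightarrow> z = hd (ys @ [x0]) + s *\<^sub>R fst m \<Longrightarrow>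
         billiard_path (z # ys @ [x0])"
    using Cons.IH[OF w m(1)] by blast
  define y' where "y' = hd (ys @ [x0])"
  obtain r where r: "ys @ [x0] = y' # r" unfolding y'_def by (cases ys) auto
  obtain y s where y: "billiard_link Q y' y" "off m y = 0" "y = y' + s *\<^sub>R fst m" "s > 0"
    "\<And>T. T \<in> sides Q \<Longrightarrow> - m \<in> Enter T \<longleftrightarrow> y \<in> T - vertices Q"
    by (rule exit[OF x0(3-5), folded y'_def]) blast
  have "- m \<in> Enter S" using m bounce_off_Enter[OF S] by simp
  then have yS: "y \<in> S" "y \<notin> vertices Q" using y(5)[OF S] by auto
  have path: "billiard_path (y # ys @ [x0])" using ext[OF y(4)] y(1,3) by (simp add: y'_def)
  define e where "e = rend S - lend S"
  have "billiard_path (z # (y # ys) @ [x0])"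
    if z: "t > 0" "billiard_link Q y z" "z = y + t *\<^sub>R fst l" for z t
  proof -
    have "sgn (z - y) = sgn (fst l)" using z(1,3) by (simp add: sgn_scaleR)
    also have "\<dots> = mirror e (sgn (fst m))" by (simp add: m(2) fst_bounce_off mirror_sgn e_def)
    also have "sgn (fst m) = sgn (y - y')" using y(3,4) by (simp add: sgn_scaleR)
    finally have "bounce Q y' y z" using bounce_iff[OF S yS] by (simp add: e_def)
    then show ?thesis using path z(2) link_sym bounce_sym r by (auto simp: billiard_path_Cons)
  qed
  moreover have "off l y = 0" using off_bounce_off_side[OF S yS(1)] y(2) m(2) by simp
  moreover have "inward y (fst l)"
    using inward_side[OF S yS] m(3) off_side_diff[of l S] by (auto simp: Enter_def)
  moreover have "y \<in> frontier Q" using y(1) by (simp add: billiard_link_def)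
  ultimately show ?case using x0 yS start_side[OF S]
    by (intro exI[of _ "y # ys"] exI[of _ x0]) auto
qed

text \<open>Besides the entry point a line of the cell meets the frontier only at its exit; a vertex
  on it outside the entry set is therefore the point where the trajectory stops.\<close>

lemma hit_iff_path:
  assumes K: "source K X" and w: "set w \<subseteq> sides Q" and v: "v \<in> vertices Q"
  shows "(v \<notin> entry X w \<and> (\<exists>l\<in>cell K w. off l v = 0)) \<longleftrightarrow>
    (\<exists>ys x0. start X x0 \<and> coded ys w \<and> billiard_path (v # ys @ [x0]))"
proof
  assume "v \<notin> entry X w \<and> (\<exists>l\<in>cell K w. off l v = 0)"
  then obtain l where l: "v \<notin> entry X w" "l \<in> cell K w" "off l v = 0" by blast
  obtain ys x0 where x0: "start X x0" "coded ys w" "hd (ys @ [x0]) \<in> frontier Q"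
      "off l (hd (ys @ [x0])) = 0" "inward (hd (ys @ [x0])) (fst l)" "start (entry X w) (hd (ys @ [x0]))"
    and ext: "\<And>z s. s > 0 \<Longrightarrow> billiard_link Q (hd (ys @ [x0])) z \<Longrightarrow> z = hd (ys @ [x0]) + s *\<^sub>R fst l \<Longrightarrow>
         billiard_path (z # ys @ [x0])"
    using cell_path[OF K w l(2)] by blast
  obtain z s where z: "billiard_link Q (hd (ys @ [x0])) z" "z = hd (ys @ [x0]) + s *\<^sub>R fst l" "s > 0"
    "\<And>q. q \<in> frontier Q \<Longrightarrow> off l q = 0 \<Longrightarrow> q = hd (ys @ [x0]) \<or> q = z"
    by (rule exit[OF x0(3-5)]) blast
  have "v \<noteq> hd (ys @ [x0])" using x0(6) l(1) by (auto simp: start_def)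
  then have "v = z" using z(4)[of v] v l(3) vertices_subset_frontier by blast
  then show "\<exists>ys x0. start X x0 \<and> coded ys w \<and> billiard_path (v # ys @ [x0])"
    using ext[OF z(3,1,2)] x0 by blast
next
  assume "\<exists>ys x0. start X x0 \<and> coded ys w \<and> billiard_path (v # ys @ [x0])"
  then obtain ys x0 where *: "start X x0" "coded ys w" "billiard_path (v # ys @ [x0])" by blast
  define y where "y = hd (ys @ [x0])"
  have "line y (v - y) \<in> cell K w" using path_cell[OF K *(1) w *(2,3)] by (simp add: y_def)
  moreover have "off (line y (v - y)) v = 0" by (simp add: off_line)
  moreover have link: "billiard_link Q y v"
    using *(3) link_sym unfolding y_def by (cases ys; cases "tl ys") (auto simp: billiard_path_Cons)
  have "v \<notin> entry X w"
  proof (cases w)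
    case Nil
    then have "ys = []" using * by simp
    then show ?thesis using Nil link K link_not_same_side[OF link] *(1)
      by (auto simp: source_def start_def y_def billiard_link_def)
  next
    case (Cons S w')
    then obtain y' ys' where "ys = y' # ys'" "y' \<in> S" using * by (auto simp: list_all2_Cons2)
    then show ?thesis using link_not_same_side[OF link] Cons w by (simp add: y_def)
  qed
  ultimately show "v \<notin> entry X w \<and> (\<exists>l\<in>cell K w. off l v = 0)" by blast
qed

lemma cell_Cons_iff_path:
  assumes K: "source K X" and w: "set w \<subseteq> sides Q" and S: "S \<in> sides Q"
  shows "cell K (S # w) \<noteq> {} \<longleftrightarrow> (\<exists>ys x0. start X x0 \<and> coded ys (S # w) \<and> billiard_path (ys @ [x0]))"
proof
  assume "cell K (S # w) \<noteq> {}"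
  then obtain l where l: "l \<in> cell K w" "- l \<in> Enter S" using cell_Cons_nonempty[OF S] by blast
  obtain ys x0 where x0: "start X x0" "coded ys w" "hd (ys @ [x0]) \<in> frontier Q"
      "off l (hd (ys @ [x0])) = 0" "inward (hd (ys @ [x0])) (fst l)"
    and ext: "\<And>z s. s > 0 \<Longrightarrow> billiard_link Q (hd (ys @ [x0])) z \<Longrightarrow> z = hd (ys @ [x0]) + s *\<^sub>R fst l \<Longrightarrow>
         billiard_path (z # ys @ [x0])"
    using cell_path[OF K w l(1)] by blast
  obtain z s where z: "billiard_link Q (hd (ys @ [x0])) z" "z = hd (ys @ [x0]) + s *\<^sub>R fst l" "s > 0"
    "\<And>T. T \<in> sides Q \<Longrightarrow> - l \<in> Enter T \<longleftrightarrow> z \<in> T - vertices Q"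
    by (rule exit[OF x0(3-5)]) blast
  have "coded (z # ys) (S # w)" using z(4)[OF S] l(2) x0(2) by simp
  then show "\<exists>ys x0. start X x0 \<and> coded ys (S # w) \<and> billiard_path (ys @ [x0])"
    using ext[OF z(3,1,2)] x0(1) by (intro exI[of _ "z # ys"]) auto
next
  assume "\<exists>ys x0. start X x0 \<and> coded ys (S # w) \<and> billiard_path (ys @ [x0])"
  then obtain z ys x0 where *: "start X x0" "coded ys w" "z \<in> S - vertices Q" "billiard_path (z # ys @ [x0])"
    by (auto simp: list_all2_Cons2)
  define y where "y = hd (ys @ [x0])"
  have l: "line y (z - y) \<in> cell K w" using path_cell[OF K *(1) w *(2,4)] by (simp add: y_def)
  have link: "billiard_link Q y z"
    using *(4) link_sym unfolding y_def by (cases ys; cases "tl ys") (auto simp: billiard_path_Cons)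
  have "- line y (z - y) \<in> Enter S"
    using exit_side[OF S, of y "line y (z - y)" z 1] link link_inward[OF link] *(3)
    by (auto simp: off_line billiard_link_def)
  then show "cell K (S # w) \<noteq> {}" using cell_Cons_nonempty[OF S] l by blast
qed

text \<open>Reversing time turns trajectories that end in \<open>v\<close> into trajectories that start in \<open>v\<close>.\<close>

lemma sum_hits_Enter:
  "(\<Sum>S\<in>sides Q. card (hits (Enter S) S n)) = (\<Sum>v\<in>vertices Q. card (words (EnterV v) (Suc n)))"
proof -
  let ?A = "SIGMA S:sides Q. hits (Enter S) S n"
  let ?B = "SIGMA v:vertices Q. words (EnterV v) (Suc n)"
  \<comment> \<open>Backwards from \<open>v\<close> the sides are met in the order of
    \<open>w\<close>, followed by \<open>S\<close>. As words are read from right to left, the new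
    code is \<open>S # rev w\<close>; the former entry side is now a hit, which raises the length to
    \<open>n + 1\<close>.\<close>
  have rev_iff: "(S \<in> sides Q \<and> (w, v) \<in> hits (Enter S) S n) \<longleftrightarrow>
      (v \<in> vertices Q \<and> S # rev w \<in> words (EnterV v) (Suc n))" for S w v
  proof (cases "S \<in> sides Q \<and> set w \<subseteq> sides Q \<and> length w = n \<and> v \<in> vertices Q")
    case True
    then have S: "S \<in> sides Q" and w: "set w \<subseteq> sides Q" "length w = n" and v: "v \<in> vertices Q" by auto
    have "(w, v) \<in> hits (Enter S) S n \<longleftrightarrow> v \<notin> entry S w \<and> (\<exists>l\<in>cell (Enter S) w. off l v = 0)"
      using True by (auto simp: hits_def words_def)
    also have "\<dots> \<longleftrightarrow> (\<exists>ys x0. start S x0 \<and> coded ys w \<and> billiard_path (v # ys @ [x0]))"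
      by (rule hit_iff_path[OF source_Enter[OF S] w(1) v])
    also have "\<dots> \<longleftrightarrow> (\<exists>zs. coded zs (w @ [S]) \<and> billiard_path (v # zs))"
    proof
      assume "\<exists>ys x0. start S x0 \<and> coded ys w \<and> billiard_path (v # ys @ [x0])"
      then obtain ys x0 where "start S x0" "coded ys w" "billiard_path (v # ys @ [x0])" by blast
      then show "\<exists>zs. coded zs (w @ [S]) \<and> billiard_path (v # zs)"
        using start_side[OF S] by (intro exI[of _ "ys @ [x0]"]) (auto intro: list_all2_appendI)
    next
      assume "\<exists>zs. coded zs (w @ [S]) \<and> billiard_path (v # zs)"
      then obtain ys us where us: "coded ys w" "coded us [S]" "billiard_path (v # ys @ us)"
        by (auto simp: list_all2_append2)
      then obtain x0 where "us = [x0]" "x0 \<in> S - vertices Q" by (auto simp: list_all2_Cons2)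
      then show "\<exists>ys x0. start S x0 \<and> coded ys w \<and> billiard_path (v # ys @ [x0])"
        using us start_side[OF S] by blast
    qed
    also have "\<dots> \<longleftrightarrow> (\<exists>zs. coded zs (S # rev w) \<and> billiard_path (zs @ [v]))"
    proof
      assume "\<exists>zs. coded zs (w @ [S]) \<and> billiard_path (v # zs)"
      then obtain zs where "coded (rev zs) (rev (w @ [S]))" "billiard_path (rev (v # zs))"
        by (auto simp: list_all2_rev billiard_path_rev simp del: rev.simps rev_append)
      then show "\<exists>zs. coded zs (S # rev w) \<and> billiard_path (zs @ [v])" by auto
    next
      assume "\<exists>zs. coded zs (S # rev w) \<and> billiard_path (zs @ [v])"
      then obtain zs where "coded (rev zs) (rev (S # rev w))" "billiard_path (rev (zs @ [v]))"
        by (auto simp: list_all2_rev billiard_path_rev simp del: rev.simps rev_append)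
      then show "\<exists>zs. coded zs (w @ [S]) \<and> billiard_path (v # zs)" by auto
    qed
    also have "\<dots> \<longleftrightarrow> cell (EnterV v) (S # rev w) \<noteq> {}"
      using cell_Cons_iff_path[OF source_EnterV[OF v] _ S, of "rev w"] w by simp
    finally show ?thesis using True by (auto simp: words_def simp del: cell.simps)
  qed (auto simp: hits_def words_def)
  have "bij_betw (\<lambda>(S, w, v). (v, S # rev w)) ?A ?B"
    unfolding bij_betw_def
  proof
    show "inj_on (\<lambda>(S, w, v). (v, S # rev w)) ?A" by (auto simp: inj_on_def)
    show "(\<lambda>(S, w, v). (v, S # rev w)) ` ?A = ?B"
    proof (intro equalityI subsetI)
      fix p assume "p \<in> ?B"
      then obtain v S u where p: "p = (v, S # u)" "v \<in> vertices Q" "S # u \<in> words (EnterV v) (Suc n)"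
        by (cases p; cases "snd p") (auto simp: words_def)
      then show "p \<in> (\<lambda>(S, w, v). (v, S # rev w)) ` ?A"
        using rev_iff[of S "rev u" v] by (intro image_eqI[of _ _ "(S, rev u, v)"]) auto
    qed (use rev_iff in auto)
  qed
  then have "card ?A = card ?B" by (rule bij_betw_same_card)
  then show ?thesis using finite_sides finite_vertices finite_hits finite_words by simp
qed

definition side_of :: "plane \<Rightarrow> plane set" where
  "side_of y = (THE S. S \<in> sides Q \<and> y \<in> S)"

lemma side_of_eq: "S \<in> sides Q \<Longrightarrow> y \<in> S \<Longrightarrow> y \<notin> vertices Q \<Longrightarrow> side_of y = S"
  unfolding side_of_def using side_unique by (intro the_equality) auto

lemma side_of: "y \<in> frontier Q \<Longrightarrow> y \<notin> vertices Q \<Longrightarrow> side_of y \<in> sides Q \<and> y \<in> side_of y"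
  using side_of_eq unfolding frontier_eq_sides by (metis UnionE)

lemma coded_side_of: "coded ys w \<Longrightarrow> set w \<subseteq> sides Q \<Longrightarrow> map side_of ys = w"
  by (induction rule: list_all2_induct) (auto simp: side_of_eq)

lemma coded_map_side_of:
  assumes "set ys \<subseteq> frontier Q - vertices Q"
  shows "coded ys (map side_of ys)" "set (map side_of ys) \<subseteq> sides Q"
  using assms side_of by (auto simp: list_all2_conv_all_nth subset_iff)

lemma path_determined:
  "billiard_path (x # y # r) \<Longrightarrow> billiard_path (x # y' # r') \<Longrightarrow> sgn (y - x) = sgn (y' - x) \<Longrightarrow>
    length r = length r' \<Longrightarrow> y # r = y' # r'"
proof (induction r arbitrary: x y y' r')
  have same: "y = y'" if "billiard_link Q x y" "billiard_link Q x y'" "sgn (y - x) = sgn (y' - x)" for x y y'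
  proof -
    have ne: "y \<noteq> x" "y' \<noteq> x" "y' \<in> frontier Q" using that by (auto simp: billiard_link_def)
    have "y' - x = norm (y' - x) *\<^sub>R sgn (y' - x)" using ne by (simp add: sgn_div_norm)
    then have "y' - x = (norm (y' - x) / norm (y - x)) *\<^sub>R (y - x)"
      unfolding that(3)[symmetric] by (simp add: sgn_div_norm divide_inverse)
    then have "y' = x + (norm (y' - x) / norm (y - x)) *\<^sub>R (y - x)" by (simp add: algebra_simps)
    then have "y' = x \<or> y' = y" by (rule link_frontier[OF that(1) ne(3)])
    then show ?thesis using ne by auto
  qed
  {
    case Nil
    then show ?case using same by auto
  next
    case (Cons z r)
    then obtain z' r'' where r': "r' = z' # r''" by (cases r') auto
    have p: "billiard_link Q x y" "bounce Q x y z" "billiard_path (y # z # r)"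
      "billiard_link Q x y'" "bounce Q x y' z'" "billiard_path (y' # z' # r'')"
      using Cons.prems by (auto simp: r' billiard_path_Cons)
    have y: "y = y'" using same p Cons.prems(3) by blast
    obtain S where S: "S \<in> sides Q" "y \<in> S" "y \<notin> vertices Q" using p(2) by (auto simp: bounce_def)
    have "sgn (z - y) = sgn (z' - y)" using bounce_iff[OF S] p(2,5) y by simp
    then show ?case using Cons.IH[of y z z' r''] p y Cons.prems(4) r' by simp
  }
qed

lemma path_interior_points:
  assumes "billiard_path (v # ys @ [x])"
  shows "set ys \<subseteq> frontier Q - vertices Q"
proof
  fix y assume "y \<in> set ys"
  then obtain i where i: "i < length ys" "y = ys ! i" by (auto simp: in_set_conv_nth)
  have "bounce Q ((v # ys @ [x]) ! i) ((v # ys @ [x]) ! Suc i) ((v # ys @ [x]) ! Suc (Suc i))"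
    "billiard_link Q ((v # ys @ [x]) ! i) ((v # ys @ [x]) ! Suc i)"
    using assms i by (auto simp: billiard_path_def)
  then show "y \<in> frontier Q - vertices Q" using i by (auto simp: bounce_def billiard_link_def nth_append)
qed

subsection \<open>Generalized diagonals\<close>

definition diagonals :: "nat \<Rightarrow> plane list set" where
  "diagonals n = {xs. generalized_diagonal Q xs \<and> combinatorial_length xs = n}"

lemma generalized_diagonal_path:
  "generalized_diagonal Q xs \<longleftrightarrow> xs \<noteq> [] \<and> hd xs \<in> vertices Q \<and> last xs \<in> vertices Q \<and> billiard_path xs"
  by (simp add: generalized_diagonal_def billiard_path_def)

lemma diagonals_0: "diagonals 0 = (\<lambda>a. [a]) ` vertices Q"
proof -
  have "xs \<in> diagonals 0 \<longleftrightarrow> (\<exists>a\<in>vertices Q. xs = [a])" for xs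
    by (cases xs; cases "tl xs")
       (auto simp: diagonals_def generalized_diagonal_path billiard_path_def combinatorial_length_def)
  then show ?thesis by blast
qed

lemma diagonals_Suc:
  "diagonals (Suc n) = {v' # ys @ [v] | v' ys v. v' \<in> vertices Q \<and> v \<in> vertices Q \<and> length ys = n \<and>
     billiard_path (v' # ys @ [v])}"
proof -
  have "(length xs = Suc (Suc n)) \<longleftrightarrow> (\<exists>v' ys v. xs = v' # ys @ [v] \<and> length ys = n)" for xs :: "plane list"
  proof
    assume "length xs = Suc (Suc n)"
    then obtain v' zs where "xs = v' # zs" "length zs = Suc n" by (cases xs) auto
    then show "\<exists>v' ys v. xs = v' # ys @ [v] \<and> length ys = n" by (cases zs rule: rev_cases) auto
  qed auto
  moreover have "combinatorial_length xs = Suc n \<longleftrightarrow> length xs = Suc (Suc n)" for xs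
    by (auto simp: combinatorial_length_def)
  ultimately show ?thesis by (auto simp: diagonals_def generalized_diagonal_path)
qed

text \<open>The list is read as a trajectory from its last point that runs into the vertex at its
  head. Unfolded along the code it becomes a segment from the image of the last point, so its two
  end vertices and its code determine it.\<close>

lemma card_diagonals_Suc:
  "finite (diagonals (Suc n))"
  "card (diagonals (Suc n)) = (\<Sum>v\<in>vertices Q. card (hits (EnterV v) {v} n))"
proof -
  let ?B = "SIGMA v:vertices Q. hits (EnterV v) {v} n"
  define g where "g xs = (last xs, map side_of (butlast (tl xs)), hd xs)" for xs
  have g: "g (v' # ys @ [v]) = (v, map side_of ys, v')" for v' ys v by (simp add: g_def butlast_append)
  have "inj_on g (diagonals (Suc n))"
  proof (rule inj_onI)
    fix xs xs' assume "xs \<in> diagonals (Suc n)" "xs' \<in> diagonals (Suc n)" and eq: "g xs = g xs'"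
    then obtain v' ys v ys' where
      xs: "xs = v' # ys @ [v]" "v' \<in> vertices Q" "v \<in> vertices Q" "length ys = n" "billiard_path (v' # ys @ [v])" and
      xs': "xs' = v' # ys' @ [v]" "length ys' = n" "billiard_path (v' # ys' @ [v])" and
      w: "map side_of ys = map side_of ys'"
      unfolding diagonals_Suc by (auto simp: g)
    define w where "w = map side_of ys"
    have c: "coded ys w" "coded ys' w" "set w \<subseteq> sides Q"
      using coded_map_side_of[OF path_interior_points[OF xs(5)]]
        coded_map_side_of[OF path_interior_points[OF xs'(3)]] w by (auto simp: w_def)
    obtain u A where u: "\<And>l. l \<in> cell (EnterV v) w \<Longrightarrow> off l u = 0"
      "\<And>l q. l \<in> cell (EnterV v) w \<Longrightarrow> q \<in> Q - entry {v} w \<Longrightarrow> off l q = 0 \<Longrightarrow> 0 < fst l \<bullet> (q - u)"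
      using cell_EnterV[OF xs(3) c(3)] by blast
    have v': "v' \<in> Q - entry {v} w"
      using hit_iff_path[OF source_EnterV[OF xs(3)] c(3) xs(2)] c(1) xs vertices_subset_frontier frontier_subset
      by auto
    \<comment> \<open>All lines of the cell pass through \<open>u\<close>, which lies behind
      \<open>v'\<close>, so the direction of arrival at \<open>v'\<close> depends on the word alone.
      The path is then recovered by following it back from \<open>v'\<close>.\<close>
    have dir: "sgn (v' - hd (zs @ [v])) = sgn (v' - u)"
      if zs: "coded zs w" "billiard_path (v' # zs @ [v])" for zs
    proof -
      define y where "y = hd (zs @ [v])"
      have l: "line y (v' - y) \<in> cell (EnterV v) w"
        using path_cell[OF source_EnterV[OF xs(3)] _ c(3) zs] by (simp add: y_def)
      then have pos: "0 < (v' - y) \<bullet> (v' - u)" using u(2)[OF l v'] by (simp add: off_line)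
      have "off (line y (v' - y)) u = 0" "off (line y (v' - y)) v' = 0" using u(1)[OF l] by (simp_all add: off_line)
      moreover have "v' - y \<noteq> 0" using pos by auto
      ultimately obtain s where "v' = u + s *\<^sub>R (v' - y)" using off_zeroE[of "line y (v' - y)" u v'] by auto
      then have s: "v' - u = s *\<^sub>R (v' - y)" by (metis add_diff_cancel_left')
      then have "0 < s * ((v' - y) \<bullet> (v' - y))" using pos by (metis inner_scaleR_right)
      then have "s > 0" using inner_ge_zero[of "v' - y"] by (auto simp: zero_less_mult_iff)
      then show ?thesis using s by (simp add: sgn_scaleR y_def del: scaleR_diff_right)
    qed
    have "sgn (hd (ys @ [v]) - v') = sgn (hd (ys' @ [v]) - v')"
      using arg_cong[OF dir[OF c(1) xs(5), folded dir[OF c(2) xs'(3)]], of uminus]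
      unfolding sgn_minus[symmetric] minus_diff_eq .
    moreover obtain r where r: "ys @ [v] = hd (ys @ [v]) # r" by (cases ys) auto
    moreover obtain r' where r': "ys' @ [v] = hd (ys' @ [v]) # r'" by (cases ys') auto
    moreover have "length r = length r'"
      using arg_cong[OF r, of length] arg_cong[OF r', of length] xs(4) xs'(2) by simp
    ultimately have "ys @ [v] = ys' @ [v]"
      using path_determined[of v' "hd (ys @ [v])" r "hd (ys' @ [v])" r'] xs(5) xs'(3) by metis
    then show "xs = xs'" using xs xs' by simp
  qed
  moreover have "g ` diagonals (Suc n) = ?B"
  proof (intro equalityI subsetI)
    fix p assume "p \<in> g ` diagonals (Suc n)"
    then obtain v' ys v where
      xs: "p = (v, map side_of ys, v')" "v' \<in> vertices Q" "v \<in> vertices Q" "length ys = n" "billiard_path (v' # ys @ [v])"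
      unfolding diagonals_Suc by (auto simp: g)
    note c = coded_map_side_of[OF path_interior_points[OF xs(5)]]
    then show "p \<in> ?B"
      using hit_iff_path[OF source_EnterV[OF xs(3)] c(2) xs(2)] xs c by (fastforce simp: hits_def words_def)
  next
    fix p assume "p \<in> ?B"
    then obtain v w v' where p: "p = (v, w, v')" "v \<in> vertices Q" "v' \<in> vertices Q" "set w \<subseteq> sides Q" "length w = n"
      "v' \<notin> entry {v} w \<and> (\<exists>l\<in>cell (EnterV v) w. off l v' = 0)"
      by (auto simp: hits_def words_def)
    then obtain ys where ys: "coded ys w" "billiard_path (v' # ys @ [v])"
      using hit_iff_path[OF source_EnterV[OF p(2)] p(4) p(3)] by auto
    then have "p = g (v' # ys @ [v])" using coded_side_of[OF ys(1) p(4)] p(1) by (simp add: g)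
    moreover have "v' # ys @ [v] \<in> diagonals (Suc n)"
      unfolding diagonals_Suc using ys p list_all2_lengthD[OF ys(1)] by auto
    ultimately show "p \<in> g ` diagonals (Suc n)" by blast
  qed
  ultimately have bij: "bij_betw g (diagonals (Suc n)) ?B" by (simp add: bij_betw_def)
  have "finite ?B" using finite_vertices finite_hits by blast
  then show "finite (diagonals (Suc n))" using bij bij_betw_finite by blast
  show "card (diagonals (Suc n)) = (\<Sum>v\<in>vertices Q. card (hits (EnterV v) {v} n))"
    using bij_betw_same_card[OF bij] finite_vertices finite_hits by simp
qed

lemma EnterV_nonempty:
  assumes "v \<in> vertices Q"
  shows "EnterV v \<noteq> {}"
proof -
  obtain p where "p \<in> interior Q" using interior_nonempty by blast
  then have "inward v (p - v)" unfolding inward_def by (intro exI[of _ 1]) auto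
  then have "line v (p - v) \<in> EnterV v" by (simp add: EnterV_def off_line)
  then show ?thesis by blast
qed

text \<open>The empty word counts once per vertex, which matches the diagonals of combinatorial
  length 0. Passing from \<open>n\<close> to \<open>n + 1\<close> letters adds the hits of words of
  length \<open>n\<close>, which are the diagonals with \<open>n + 1\<close> links.\<close>

lemma num_gen_diagonals_eq: "num_gen_diagonals Q n = (\<Sum>v\<in>vertices Q. card (words (EnterV v) n))"
proof -
  have num: "num_gen_diagonals Q n = card (\<Union>k\<le>n. diagonals k)" for n
    unfolding num_gen_diagonals_def diagonals_def by (rule arg_cong[of _ _ card]) auto
  have fin: "finite (diagonals k)" for k
    by (cases k) (auto simp: diagonals_0 finite_vertices card_diagonals_Suc)
  show ?thesis
  proof (induction n)
    case 0
    have "words (EnterV v) 0 = {[]}" if "v \<in> vertices Q" for v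
      using EnterV_nonempty[OF that] by (auto simp: words_def)
    then show ?case by (simp add: num diagonals_0 card_image inj_on_def)
  next
    case (Suc n)
    have "(\<Union>k\<le>n. diagonals k) \<inter> diagonals (Suc n) = {}" by (auto simp: diagonals_def)
    then have "num_gen_diagonals Q (Suc n) = num_gen_diagonals Q n + card (diagonals (Suc n))"
      using fin by (simp add: num atMost_Suc card_Un_disjoint Un_commute Int_commute)
    then show ?case
      using Suc.IH card_words_Suc[OF source_EnterV] by (simp add: card_diagonals_Suc sum.distrib)
  qed
qed

text \<open>Time reversal turns the hits of words of length \<open>n\<close> from the sides into the
  words of length \<open>n + 1\<close> from the vertices, whence the new summand. The base case is
  the equality of the numbers of sides and vertices.\<close>

lemma sum_words_Enter:
  "(\<Sum>S\<in>sides Q. card (words (Enter S) n)) = (\<Sum>j\<le>n. num_gen_diagonals Q j)"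
proof (induction n)
  case 0
  have "words (Enter S) 0 = {[]}" if S: "S \<in> sides Q" for S
  proof -
    obtain x where x: "x \<in> S" "x \<notin> vertices Q" using side_has_point[OF S] by blast
    obtain p where p: "p \<in> interior Q" using interior_nonempty by blast
    then have "p \<in> Q" "p \<notin> S" using interior_subset frontier_eq_sides frontier_not_interior S by blast+
    then have "Enter S \<noteq> {}" using line_Enter[OF S x] by blast
    then show ?thesis by (auto simp: words_def)
  qed
  moreover have "words (EnterV v) 0 = {[]}" if "v \<in> vertices Q" for v
    using EnterV_nonempty[OF that] by (auto simp: words_def)
  ultimately show ?case by (simp add: num_gen_diagonals_eq card_sides_eq_card_vertices)
next
  case (Suc n)
  then show ?case
    using card_words_Suc[OF source_Enter] by (simp add: sum.distrib sum_hits_Enter num_gen_diagonals_eq)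
qed

subsection \<open>Infinite orbits\<close>

text \<open>The orbit along \<open>l\<close> never meets a vertex, even when the sides to bounce off are chosen freely.\<close>

definition generic :: "plane \<times> real \<Rightarrow> bool" where
  "generic l \<longleftrightarrow> (\<forall>ws\<in>lists (sides Q). \<forall>v\<in>vertices Q. off (fold bounce_off ws l) v \<noteq> 0)"

lemma generic_bounce_off: "generic l \<Longrightarrow> S \<in> sides Q \<Longrightarrow> generic (bounce_off S l)"
  unfolding generic_def
proof (intro ballI)
  fix ws v assume "\<forall>ws\<in>lists (sides Q). \<forall>v\<in>vertices Q. off (fold bounce_off ws l) v \<noteq> 0"
    and "S \<in> sides Q" "ws \<in> lists (sides Q)" "v \<in> vertices Q"
  then show "off (fold bounce_off ws (bounce_off S l)) v \<noteq> 0"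
    by (auto dest!: bspec[where x = "S # ws"])
qed

lemma generic_off: "generic l \<Longrightarrow> v \<in> vertices Q \<Longrightarrow> off l v \<noteq> 0"
  by (auto simp: generic_def dest!: bspec[where x = "[]"])

text \<open>A bounce turns a parallel displacement into the opposite one, so its size survives any
  number of bounces.\<close>

lemma off_fold_translate: "\<bar>off (fold bounce_off ws (l + (0, t))) p - off (fold bounce_off ws l) p\<bar> = \<bar>t\<bar>"
proof -
  have [simp]: "off (0, c) p = c" for c p by (simp add: off_def)
  have shift: "bounce_off S (l + (0, t)) = bounce_off S l + (0, - t)" for S l t
    by (rule state_eqI[of _ _ "lend S"]) (simp_all add: fst_bounce_off off_bounce_off)
  show ?thesis
  proof (induction ws arbitrary: l t)
    case Nil
    then show ?case by (simp add: off_def)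
  next
    case (Cons S ws)
    then show ?case using Cons.IH[of "bounce_off S l" "- t"] by (simp add: shift)
  qed
qed

lemma generic_exists:
  assumes "open C" "l \<in> C"
  obtains m where "m \<in> C" "generic m"
proof -
  obtain \<epsilon> where \<epsilon>: "\<epsilon> > 0" "\<And>t. \<bar>t\<bar> < \<epsilon> \<Longrightarrow> l + t *\<^sub>R (0, 1) \<in> C"
    using open_perturb[OF assms, of "(0, 1)"] by blast
  define f where "f ws v t = off (fold bounce_off ws (l + (0, t))) v" for ws v t
  have diff: "\<bar>f ws v t - f ws v 0\<bar> = \<bar>t\<bar>" for ws v t
    using off_fold_translate[of ws l t v] by (simp add: f_def zero_prod_def[symmetric])
  \<comment> \<open>At a zero the change from \<open>f ws v 0\<close> has size
    \<open>\<bar>t\<bar>\<close>, so each word and vertex exclude at most two values of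
    \<open>t\<close>.\<close>
  have "{t. f ws v t = 0} \<subseteq> {f ws v 0, - f ws v 0}" for ws v
  proof
    fix t assume "t \<in> {t. f ws v t = 0}"
    then have "\<bar>f ws v 0\<bar> = \<bar>t\<bar>" using diff[of ws v t] by simp
    then show "t \<in> {f ws v 0, - f ws v 0}" by (auto simp: abs_if split: if_splits)
  qed
  then have "countable {t. f ws v t = 0}" for ws v
    by (meson countable_finite finite.emptyI finite.insertI finite_subset)
  then have "countable (\<Union>ws\<in>lists (sides Q). \<Union>v\<in>vertices Q. {t. f ws v t = 0})"
    using finite_sides finite_vertices by (intro countable_UN countable_lists) (auto intro: countable_finite)
  moreover have "uncountable {-\<epsilon><..<\<epsilon>}" using \<epsilon>(1) uncountable_open_interval by auto
  ultimately obtain t where t: "t \<in> {-\<epsilon><..<\<epsilon>}" "t \<notin> (\<Union>ws\<in>lists (sides Q). \<Union>v\<in>vertices Q. {t. f ws v t = 0})"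
    by (meson countable_subset subsetI)
  then have "generic (l + (0, t))" by (auto simp: generic_def f_def)
  moreover have "l + (0, t) \<in> C" using \<epsilon>(2)[of t] t(1) by auto
  ultimately show ?thesis using that by blast
qed

lemma forward_orbit:
  assumes "y \<in> frontier Q" "off l y = 0" "inward y (fst l)" "generic l"
  obtains x where "x 0 = y" "\<And>i. x (Suc i) \<notin> vertices Q" "\<And>i. billiard_link Q (x i) (x (Suc i))"
    "\<And>i. bounce Q (x i) (x (Suc i)) (x (Suc (Suc i)))" "\<exists>s>0. x 1 = y + s *\<^sub>R fst l"
proof -
  \<comment> \<open>A state is a boundary point with its outgoing line. Genericity is part of the
    invariant because it keeps the next exit off the vertices.\<close>
  define ok where "ok p \<longleftrightarrow> fst p \<in> frontier Q \<and> off (snd p) (fst p) = 0 \<and> inward (fst p) (fst (snd p)) \<and> generic (snd p)"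
    for p :: "plane \<times> plane \<times> real"
  define step where "step p q \<longleftrightarrow> billiard_link Q (fst p) (fst q) \<and> (\<exists>s>0. fst q = fst p + s *\<^sub>R fst (snd p)) \<and>
      (\<exists>S\<in>sides Q. fst q \<in> S - vertices Q \<and> fst (snd q) = mirror (rend S - lend S) (fst (snd p)))"
    for p q :: "plane \<times> plane \<times> real"
  have "\<exists>q. ok q \<and> step p q" if ok: "ok p" for p
  proof -
    have p: "fst p \<in> frontier Q" "off (snd p) (fst p) = 0" "inward (fst p) (fst (snd p))" "generic (snd p)"
      using ok by (auto simp: ok_def)
    obtain z s where z: "billiard_link Q (fst p) z" "off (snd p) z = 0" "z = fst p + s *\<^sub>R fst (snd p)" "s > 0"
      "\<And>S. S \<in> sides Q \<Longrightarrow> - snd p \<in> Enter S \<longleftrightarrow> z \<in> S - vertices Q"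
      by (rule exit[OF p(1-3)]) blast
    have zf: "z \<in> frontier Q" using z(1) by (simp add: billiard_link_def)
    have zv: "z \<notin> vertices Q" using generic_off[OF p(4)] z(2) by blast
    define S where "S = side_of z"
    have S: "S \<in> sides Q" "z \<in> S" using side_of[OF zf zv] by (auto simp: S_def)
    define m where "m = bounce_off S (snd p)"
    have "m \<in> Enter S" using z(5)[OF S(1)] S(2) zv bounce_off_Enter[OF S(1)] by (simp add: m_def)
    then have "inward z (fst m)"
      using inward_side[OF S zv] off_side_diff[of m S] by (auto simp: Enter_def)
    moreover have "off m z = 0" using off_bounce_off_side[OF S] z(2) by (simp add: m_def)
    moreover have "generic m" using generic_bounce_off[OF p(4) S(1)] by (simp add: m_def)
    ultimately have "ok (z, m)" using zf by (simp add: ok_def)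
    moreover have "step p (z, m)"
      using z S zv by (auto simp: step_def m_def fst_bounce_off)
    ultimately show ?thesis by blast
  qed
  \<comment> \<open>The clause for \<open>n = 0\<close> ties the chosen sequence to the given
    initial state.\<close>
  then have "\<exists>f. \<forall>n. (ok (f n) \<and> (n = 0 \<longrightarrow> f n = (y, l))) \<and> step (f n) (f (Suc n))"
  proof (intro dependent_nat_choice)
    show "\<exists>p. ok p \<and> (0 = (0::nat) \<longrightarrow> p = (y, l))"
      using assms by (intro exI[of _ "(y, l)"]) (simp add: ok_def)
  qed auto
  then obtain f where f: "f 0 = (y, l)" "\<And>n. step (f n) (f (Suc n))" by blast
  define x where "x n = fst (f n)" for n
  have "bounce Q (x i) (x (Suc i)) (x (Suc (Suc i)))" for i
  proof -
    obtain s S where S: "s > 0" "x (Suc i) = x i + s *\<^sub>R fst (snd (f i))" "S \<in> sides Q"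
      "x (Suc i) \<in> S" "x (Suc i) \<notin> vertices Q"
      "fst (snd (f (Suc i))) = mirror (rend S - lend S) (fst (snd (f i)))"
      using f(2)[of i] by (auto simp: step_def x_def)
    obtain r where r: "r > 0" "x (Suc (Suc i)) = x (Suc i) + r *\<^sub>R fst (snd (f (Suc i)))"
      using f(2)[of "Suc i"] by (auto simp: step_def x_def)
    have "sgn (x (Suc (Suc i)) - x (Suc i)) = sgn (fst (snd (f (Suc i))))"
      using r by (simp add: sgn_scaleR)
    also have "\<dots> = mirror (rend S - lend S) (sgn (fst (snd (f i))))" by (simp add: S(6) mirror_sgn)
    also have "sgn (fst (snd (f i))) = sgn (x (Suc i) - x i)" using S(1,2) by (simp add: sgn_scaleR)
    finally show ?thesis using bounce_iff[OF S(3-5)] by simp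
  qed
  moreover have "\<exists>s>0. x 1 = y + s *\<^sub>R fst l" using f(2)[of 0] f(1) by (auto simp: step_def x_def)
  moreover have "billiard_link Q (x i) (x (Suc i))" "x (Suc i) \<notin> vertices Q" for i
    using f(2)[of i] by (auto simp: step_def x_def)
  moreover have "x 0 = y" using f(1) by (simp add: x_def)
  ultimately show ?thesis using that[of x] by blast
qed

text \<open>The cell is open, hence contains a generic line. The cell provides its past with the
  required code, and genericity its infinite future.\<close>

lemma word_orbit:
  assumes S: "S \<in> sides Q" and w: "w \<in> words (Enter S) n"
  shows "\<exists>x. billiard_orbit Q x \<and> (\<forall>i\<le>n. x i \<in> (S # rev w) ! i)"
proof -
  have ws: "set w \<subseteq> sides Q" "length w = n" using w by (auto simp: words_def)
  obtain l0 where "l0 \<in> cell (Enter S) w" using w by (auto simp: words_def)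
  then obtain l where l: "l \<in> cell (Enter S) w" "generic l"
    using generic_exists[OF open_cell[OF open_Enter]] by blast
  obtain ys x0 where x0: "start S x0" "coded ys w" "hd (ys @ [x0]) \<in> frontier Q"
      "off l (hd (ys @ [x0])) = 0" "inward (hd (ys @ [x0])) (fst l)"
    and ext: "\<And>z s. s > 0 \<Longrightarrow> billiard_link Q (hd (ys @ [x0])) z \<Longrightarrow> z = hd (ys @ [x0]) + s *\<^sub>R fst l \<Longrightarrow>
         billiard_path (z # ys @ [x0])"
    using cell_path[OF source_Enter[OF S] ws(1) l(1)] by blast
  obtain y where y: "y 0 = hd (ys @ [x0])" "\<And>i. y (Suc i) \<notin> vertices Q" "\<And>i. billiard_link Q (y i) (y (Suc i))"
    "\<And>i. bounce Q (y i) (y (Suc i)) (y (Suc (Suc i)))" "\<exists>s>0. y 1 = hd (ys @ [x0]) + s *\<^sub>R fst l"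
    by (rule forward_orbit[OF x0(3-5) l(2)]) blast
  have len: "length ys = n" using list_all2_lengthD[OF x0(2)] ws by simp
  have "billiard_path (y 1 # ys @ [x0])" using ext y(1) y(3)[of 0] y(5) by auto
  then have path: "billiard_path (x0 # rev ys @ [y 1])"
    using billiard_path_rev[of "y 1 # ys @ [x0]"] by simp
  define ts where "ts = x0 # rev ys @ [y 1]"
  have ts: "billiard_path ts" using path by (simp add: ts_def)
  \<comment> \<open>The finite path \<open>ts\<close> and the orbit \<open>y\<close> overlap in the
    two points \<open>y 0\<close> and \<open>y 1\<close>. Every link and every bounce therefore lies
    entirely in one of them, and nothing has to be checked across the seam.\<close>
  define x where "x i = (if i < n then ts ! i else y (i - n))" for i
  have "coded (rev (ys @ [x0])) (rev (w @ [S]))"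
    using x0(1,2) start_side[OF S] by (auto simp: list_all2_rev intro: list_all2_appendI)
  then have code: "coded (x0 # rev ys) (S # rev w)" by simp
  have last: "ts ! n = y 0"
    using y(1) len by (cases ys) (auto simp: ts_def nth_append nth_Cons')
  have lents: "length ts = n + 2" using len by (simp add: ts_def)
  have xts: "x i = ts ! i" if i: "i \<le> Suc n" for i
  proof -
    consider "i < n" | "i = n" | "i = Suc n" using i by linarith
    then show ?thesis using last len by cases (auto simp: x_def ts_def nth_append)
  qed
  have pts: "x i \<in> (S # rev w) ! i \<and> x i \<notin> vertices Q" if "i \<le> n" for i
  proof -
    have "(x0 # rev ys) ! i \<in> (S # rev w) ! i - vertices Q"
      using list_all2_nthD[OF code, of i] that len by simp
    moreover have "x i = (x0 # rev ys) ! i" using xts[of i] that len nth_append[of "x0 # rev ys" "[y 1]" i]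
      by (simp add: ts_def del: nth_Cons_Suc)
    ultimately show ?thesis by auto
  qed
  have "billiard_orbit Q x"
    unfolding billiard_orbit_def
  proof (intro allI conjI)
    fix i
    show "x i \<notin> vertices Q"
    proof (cases "i \<le> n")
      case False
      then show ?thesis using y(2)[of "i - Suc n"] by (simp add: x_def Suc_diff_Suc)
    qed (use pts in auto)
    show "billiard_link Q (x i) (x (Suc i))"
    proof (cases "i \<le> n")
      case True
      then show ?thesis using ts xts[of i] xts[of "Suc i"] lents by (simp add: billiard_path_def)
    next
      case False
      then show ?thesis using y(3)[of "i - n"] by (simp add: x_def Suc_diff_le)
    qed
    show "bounce Q (x i) (x (Suc i)) (x (Suc (Suc i)))"
    proof (cases "i < n")
      case True
      then show ?thesis using ts xts[of i] xts[of "Suc i"] xts[of "Suc (Suc i)"] lents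
        by (simp add: billiard_path_def)
    next
      case False
      then show ?thesis using y(4)[of "i - n"] by (simp add: x_def Suc_diff_le)
    qed
  qed
  then show ?thesis using pts by blast
qed

lemma orbit_word:
  assumes x: "billiard_orbit Q x" and S: "\<And>i. i \<le> n \<Longrightarrow> S i \<in> sides Q \<and> x (m + i) \<in> S i"
  shows "map S (rev [1..<Suc n]) \<in> words (Enter (S 0)) n"
proof -
  define w where "w = map S (rev [1..<Suc n])"
  define ys where "ys = map (\<lambda>i. x (m + i)) (rev [1..<Suc n])"
  have nv: "x i \<notin> vertices Q" for i using x by (auto simp: billiard_orbit_def)
  have w: "set w \<subseteq> sides Q" "length w = n" using S by (auto simp: w_def)
  have c: "coded ys w"
    unfolding w_def ys_def by (auto simp: list.rel_map list_all2_same nv intro!: list.rel_refl_strong) (use S in auto)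
  \<comment> \<open>One point beyond the last coded side is taken, since a cell consists of the
    lines that leave the last bounce.\<close>
  have "billiard_path (map (\<lambda>i. x (m + i)) [0..<n + 2])"
    using x by (auto simp: billiard_path_def billiard_orbit_def simp del: upt_Suc)
  moreover have "rev (map (\<lambda>i. x (m + i)) [0..<n + 2]) = x (m + Suc n) # ys @ [x m]"
  proof -
    have "[0..<n + 2] = 0 # [1..<Suc n] @ [Suc n]" by (simp add: upt_conv_Cons)
    then show ?thesis by (simp add: ys_def rev_map del: upt_Suc)
  qed
  ultimately have "billiard_path (x (m + Suc n) # ys @ [x m])" by (metis billiard_path_rev)
  moreover have S0: "S 0 \<in> sides Q" "start (S 0) (x m)" using S[of 0] start_side[of "S 0" "x m"] nv by auto
  ultimately have "cell (Enter (S 0)) w \<noteq> {}"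
    using path_cell[OF source_Enter S0(2) w(1) c] by blast
  then show ?thesis using w by (simp add: words_def w_def)
qed

text \<open>The first letter is the side of entry, which selects the source and is not a letter of
  the cell word; the other \<open>n\<close> letters in reverse order form that word.\<close>

lemma complexity_Suc:
  assumes "inj_on lab (sides Q)"
  shows "complexity lab Q (Suc n) = (\<Sum>S\<in>sides Q. card (words (Enter S) n))"
proof -
  let ?W = "SIGMA S:sides Q. words (Enter S) n"
  let ?f = "\<lambda>(S, w). map lab (S # rev w)"
  have "billiard_language lab Q (Suc n) = ?f ` ?W"
  proof (intro equalityI subsetI)
    fix u assume "u \<in> billiard_language lab Q (Suc n)"
    then obtain x m where u: "length u = Suc n" "billiard_orbit Q x"
      "\<forall>i<Suc n. \<exists>S\<in>sides Q. x (m + i) \<in> S \<and> u ! i = lab S"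
      by (auto simp: billiard_language_def)
    then obtain S where S: "\<And>i. i < Suc n \<Longrightarrow> S i \<in> sides Q \<and> x (m + i) \<in> S i \<and> u ! i = lab (S i)"
      by metis
    have "map S (rev [1..<Suc n]) \<in> words (Enter (S 0)) n"
      by (rule orbit_word[OF u(2), where m = m]) (use S in auto)
    moreover have "u = map lab (S 0 # rev (map S (rev [1..<Suc n])))"
      using u(1) S by (intro nth_equalityI) (auto simp: nth_Cons' rev_map simp del: upt_Suc)
    ultimately show "u \<in> ?f ` ?W" using S[of 0] by (intro image_eqI[of _ _ "(S 0, map S (rev [1..<Suc n]))"]) auto
  next
    fix u assume "u \<in> ?f ` ?W"
    then obtain S w where u: "S \<in> sides Q" "w \<in> words (Enter S) n" "u = map lab (S # rev w)" by auto
    obtain x where x: "billiard_orbit Q x" "\<forall>i\<le>n. x i \<in> (S # rev w) ! i"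
      using word_orbit[OF u(1,2)] by blast
    have len: "length w = n" "set w \<subseteq> sides Q" using u(2) by (auto simp: words_def)
    have "(S # rev w) ! i \<in> sides Q" if "i < Suc n" for i
      using nth_mem[of i "S # rev w"] that len u(1) by auto
    moreover have "u ! i = lab ((S # rev w) ! i)" if "i < Suc n" for i
      unfolding u(3) using that len by (intro nth_map) simp
    ultimately have "\<forall>i<Suc n. \<exists>T\<in>sides Q. x (0 + i) \<in> T \<and> u ! i = lab T"
      using x(2) by (metis add_0 less_Suc_eq_le)
    moreover have "length u = Suc n" using u(3) len by simp
    ultimately show "u \<in> billiard_language lab Q (Suc n)" using x(1) unfolding billiard_language_def by blast
  qed
  moreover have "inj_on ?f ?W"
  proof (rule inj_onI)
    fix p q assume pq: "p \<in> ?W" "q \<in> ?W" "?f p = ?f q"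
    then obtain S w T v where e: "p = (S, w)" "q = (T, v)" "set (S # rev w) \<subseteq> sides Q" "set (T # rev v) \<subseteq> sides Q"
      "map lab (S # rev w) = map lab (T # rev v)"
      by (auto simp: words_def)
    have "S # rev w = T # rev v"
      by (rule map_inj_on[OF e(5)]) (use e(3,4) in \<open>blast intro: inj_on_subset[OF assms]\<close>)
    then show "p = q" using e(1,2) by simp
  qed
  ultimately show ?thesis
    unfolding complexity_def using finite_sides finite_words by (simp add: card_image)
qed

end

theorem theorem1p1:
  fixes Q :: "(real^2) set" and A :: "'a set" and lab :: "(real^2) set \<Rightarrow> 'a" and n :: nat
  assumes "convex_polygon Q"
    and "bij_betw lab (sides Q) A"
    and "n \<ge> 1"
  shows "complexity lab Q n = (\<Sum>j = 0..n - 1. num_gen_diagonals Q j)"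
proof -
  interpret polygon Q by unfold_locales (rule assms(1))
  obtain k where k: "n = Suc k" using assms(3) by (cases n) auto
  have "inj_on lab (sides Q)" using assms(2) by (rule bij_betw_imp_inj_on)
  from complexity_Suc[OF this, of k] show ?thesis
    by (simp add: k sum_words_Enter atLeast0AtMost)
qed

end
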